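(* Let $P_n$ be the path on $n\ge 1$ vertices. If $n$ is even, then $2\lfloor n/16\rfloor+1\le c^A_g(P_n)\le 4\lceil n/16\rceil+5$ and $2\lfloor n/16\rfloor-5\le c^I_g(P_n)\le 4\lceil n/16\rceil-1$. If $n$ is odd, then $2\lfloor n/16\rfloor-4\le c^A_g(P_n)\le 4\lceil n/16\rceil$ and $2\lfloor n/16\rfloor\le c^I_g(P_n)\le 4\lceil n/16\rceil+4$.
   Context: The cordiality game on a finite simple graph $G$ is played by two players, Admirable (A) and Impish (I), who alternately select a not-yet-labeled vertex of $G$ until all vertices are labeled; Admirable labels each vertex she selects by $0$ and Impish labels each vertex he selects by $1$. Each edge receives the sum modulo $2$ of the labels of its endpoints. Let $e_0$ and $e_1$ be the numbers of edges labeled $0$ and $1$ at the end; the discrepancy is $d=|e_1-e_0|$. Admirable tries to minimize $d$ and Impish tries to maximize $d$. $c^A_g(G)$ is the value of $d$ under optimal play of both players when Admirable moves first, and $c^I_g(G)$ is the value under optimal play when Impish moves first. *)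

theory Defs
  imports Complex_Main
begin

record 'a graph =
  verts :: "'a set"
  edges :: "'a set set"

definition fin_simple_graph :: "'a graph \<Rightarrow> bool" where
  "fin_simple_graph G \<longleftrightarrow> finite (verts G) \<and> (\<forall>e\<in>edges G. e \<subseteq> verts G \<and> card e = 2)"

definition path_graph :: "nat \<Rightarrow> nat graph" where
  "path_graph n = \<lparr>verts = {1..n}, edges = {{i, i + 1} | i. 1 \<le> i \<and> i < n}\<rparr>"

lemma fin_simple_graph_path: "fin_simple_graph (path_graph n)"
  by (auto simp: fin_simple_graph_def path_graph_def)

(* A position of the game is a partial labeling; its domain is the set of labeled vertices. *)
type_synonym 'a labeling = "'a \<Rightarrow> nat option"

definition edge_label :: "'a labeling \<Rightarrow> 'a set \<Rightarrow> nat" where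
  "edge_label L e = (\<Sum>v\<in>e. the (L v)) mod 2"

definition edge_count :: "'a graph \<Rightarrow> 'a labeling \<Rightarrow> nat \<Rightarrow> nat" where
  "edge_count G L b = card {e \<in> edges G. edge_label L e = b}"

definition discrepancy :: "'a graph \<Rightarrow> 'a labeling \<Rightarrow> int" where
  "discrepancy G L = \<bar>int (edge_count G L 1) - int (edge_count G L 0)\<bar>"

datatype player = Admirable | Impish

(* Minimax value of the position L with the given player to move. The finiteness test only
   serves to make the recursion total on arbitrary records. *)
function game_value :: "'a graph \<Rightarrow> player \<Rightarrow> 'a labeling \<Rightarrow> int" where
  "game_value G p L =
    (if infinite (verts G) \<or> verts G \<subseteq> dom L then discrepancy G L
     else case p of
       Admirable \<Rightarrow> Min ((\<lambda>v. game_value G Impish (L(v \<mapsto> 0))) ` (verts G - dom L))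
     | Impish \<Rightarrow> Max ((\<lambda>v. game_value G Admirable (L(v \<mapsto> 1))) ` (verts G - dom L)))"
  by pat_completeness auto
termination
  by (relation "measure (\<lambda>(G, p, L). card (verts G - dom L))")
     (auto simp: card_gt_0_iff intro!: diff_less)

(* The recursion equation is unconditional and would make the simplifier loop. *)
declare game_value.simps [simp del]

definition cg_A :: "'a graph \<Rightarrow> int" where
  "cg_A G = game_value G Admirable Map.empty"

definition cg_I :: "'a graph \<Rightarrow> int" where
  "cg_I G = game_value G Impish Map.empty"

end

theory Submission
  imports Defs "HOL-Library.Multiset"
begin

text \<open>
  Write every label relative to the player who is not about to move: 1 for that replying player,
  -1 for the opponent, 0 for a blank vertex. Then the final value of e1 - e0 is the sum of
  -x(i) * x(i+1), whoever replies, so one analysis of replying strategies serves both players: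
  Admirable confines this sum to a symmetric interval, Impish keeps it large.

  On 16 blank vertices the replying player can confine the sum to [-3, 3], and with another strategy
  can keep it at least 3; on 4, 6 and 14 vertices the intervals are [-1, 1], [-1, 1] and [-3, 3]. On
  a path cut into even blocks she replies in the block where the opponent has just moved, and each
  edge between blocks shifts the sum by at most 1. This settles even n with the opponent starting.
  A player who starts labels an endpoint and replies from then on. An extra vertex is ignored; when
  the opponent takes it, the replying player labels an arbitrary vertex and pretends that she has not,
  which never hurts because some vertex is left over for her at the end.
\<close>

text \<open>The joins dictate the constants. Blocks confined to [-3, 3] and joined at a cost of 1
  spend 4 per 16 blanks, and k of them end at 4k - 1. For the lower bound, two blanks are worth
  exactly 1, which the next join consumes, so pairing vertices alone never gets beyond 1. A growing
  bound needs a block that guarantees more than a join costs; 16 blanks guarantee 3, a net gain of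
  2.

  The obstacle is the size of the game on 16 blanks. It is tamed in three ways. A position is
  reduced to its multiset of gaps: distinct gaps share labelled vertices but no edge, so here,
  unlike for blocks, strategies add up without loss. Parts whose exact enforceable value is known
  are removed, and the interval still to be reached is shifted accordingly. Finally, a claim records
  one reply to each move of the opponent, so that nothing has to be searched for and checking is
  evaluation.\<close>

section \<open>Replying strategies\<close>

text \<open>The witness \<open>t\<^sub>0\<close> keeps \<open>turn\<close> from holding vacuously in
  a finished position, where the value has to decide. Each move of the opponent needs a reply, so
  the opponent never moves last. Moves and values are parameters because the same game is played on
  words and on gaps.\<close>

inductive forces :: "(int \<Rightarrow> 's \<Rightarrow> 's \<Rightarrow> bool) \<Rightarrow> ('s \<Rightarrow> int) \<Rightarrow> int \<Rightarrow> int \<Rightarrow> 's \<Rightarrow> bool"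
  for mv v lo hi where
  final: "(\<And>t. \<not> mv (- 1) s t) \<Longrightarrow> lo \<le> v s \<Longrightarrow> v s \<le> hi \<Longrightarrow> forces mv v lo hi s"
| turn: "mv (- 1) s t\<^sub>0 \<Longrightarrow> (\<And>t. mv (- 1) s t \<Longrightarrow> \<exists>s'. mv 1 t s' \<and> forces mv v lo hi s') \<Longrightarrow>
    forces mv v lo hi s"

lemma forces_weaken:
  assumes "forces mv v lo hi s" "lo' \<le> lo" "hi \<le> hi'"
  shows "forces mv v lo' hi' s"
  using assms(1)
proof induction
  case (final s)
  then show ?case using assms(2,3) by (intro forces.final) auto
next
  case (turn s t\<^sub>0)
  show ?case by (rule forces.turn, rule turn.hyps, drule turn.IH, blast)
qed

text \<open>Two games side by side: the reply goes to the component in which the opponent has just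
  moved, so each strategy sees a regular play of its own game. \<open>a\<close> and \<open>b\<close>
  bound the interaction of the components: one edge for words, nothing for gaps. The invariant
  \<open>I\<close> carries the range of the labels.\<close>

lemma forces_sum:
  assumes "forces mv\<^sub>1 v\<^sub>1 lo\<^sub>1 hi\<^sub>1 s" and "forces mv\<^sub>2 v\<^sub>2 lo\<^sub>2 hi\<^sub>2 t" and "I s t"
    and split: "\<And>x s t r. x \<in> {- 1, 1} \<Longrightarrow> I s t \<Longrightarrow> mv\<^sub>3 x (f s t) r \<Longrightarrow>
      (\<exists>s'. mv\<^sub>1 x s s' \<and> r = f s' t) \<or> (\<exists>t'. mv\<^sub>2 x t t' \<and> r = f s t')"
    and left: "\<And>x s s' t. x \<in> {- 1, 1} \<Longrightarrow> I s t \<Longrightarrow> mv\<^sub>1 x s s' \<Longrightarrow> mv\<^sub>3 x (f s t) (f s' t) \<and> I s' t"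
    and right: "\<And>x s t t'. x \<in> {- 1, 1} \<Longrightarrow> I s t \<Longrightarrow> mv\<^sub>2 x t t' \<Longrightarrow> mv\<^sub>3 x (f s t) (f s t') \<and> I s t'"
    and lower: "\<And>s t. I s t \<Longrightarrow> v\<^sub>1 s + v\<^sub>2 t + a \<le> v\<^sub>3 (f s t)"
    and upper: "\<And>s t. I s t \<Longrightarrow> v\<^sub>3 (f s t) \<le> v\<^sub>1 s + v\<^sub>2 t + b"
  shows "forces mv\<^sub>3 v\<^sub>3 (lo\<^sub>1 + lo\<^sub>2 + a) (hi\<^sub>1 + hi\<^sub>2 + b) (f s t)"
  using assms(1-3)
proof (induction arbitrary: t)
  case (final s)
  \<comment> \<open>The first component is finished; an inner induction follows the second strategy
    alone.\<close>
  from final.prems(1,2) show ?case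
  proof induction
    case (final t)
    show ?case
    proof (rule forces.final)
      show "\<not> mv\<^sub>3 (- 1) (f s t) r" for r
        using split[of "- 1" s t r] final \<open>\<And>t. \<not> mv\<^sub>1 (- 1) s t\<close> by blast
    qed (use lower[of s t] upper[of s t] final \<open>lo\<^sub>1 \<le> v\<^sub>1 s\<close> \<open>v\<^sub>1 s \<le> hi\<^sub>1\<close> in auto)
  next
    case (turn t t\<^sub>0)
    show ?case
    proof (rule forces.turn)
      show "mv\<^sub>3 (- 1) (f s t) (f s t\<^sub>0)"
        using right turn by blast
      fix r assume "mv\<^sub>3 (- 1) (f s t) r"
      then obtain t' where t': "mv\<^sub>2 (- 1) t t'" "r = f s t'"
        using split[of "- 1" s t r] turn.prems \<open>\<And>t. \<not> mv\<^sub>1 (- 1) s t\<close> by blast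
      then have I': "I s t'" using right[of "- 1"] turn.prems by blast
      from turn.IH[OF t'(1)] turn.prems obtain t'' where "mv\<^sub>2 1 t' t''"
        and "I s t'' \<Longrightarrow> forces mv\<^sub>3 v\<^sub>3 (lo\<^sub>1 + lo\<^sub>2 + a) (hi\<^sub>1 + hi\<^sub>2 + b) (f s t'')"
        by auto
      then show "\<exists>s'. mv\<^sub>3 1 r s' \<and> forces mv\<^sub>3 v\<^sub>3 (lo\<^sub>1 + lo\<^sub>2 + a) (hi\<^sub>1 + hi\<^sub>2 + b) s'"
        using right[of 1 s t'] I' t'(2) by blast
    qed
  qed
next
  case (turn s s\<^sub>0)
  \<comment> \<open>The reply to a move in the first component. The second one is handed on with its
    whole strategy, which is why the outer induction generalises over \<open>t\<close>.\<close>
  have goal: "\<exists>s'. mv\<^sub>3 1 r s' \<and> forces mv\<^sub>3 v\<^sub>3 (lo\<^sub>1 + lo\<^sub>2 + a) (hi\<^sub>1 + hi\<^sub>2 + b) s'"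
    if "mv\<^sub>1 (- 1) s s'" "r = f s' t" "forces mv\<^sub>2 v\<^sub>2 lo\<^sub>2 hi\<^sub>2 t" "I s t" for r s' t
  proof -
    have I': "I s' t" using left[of "- 1"] that by blast
    from turn.IH[OF that(1)] obtain s'' where "mv\<^sub>1 1 s' s''"
      and "\<And>t. forces mv\<^sub>2 v\<^sub>2 lo\<^sub>2 hi\<^sub>2 t \<Longrightarrow> I s'' t \<Longrightarrow> forces mv\<^sub>3 v\<^sub>3 (lo\<^sub>1 + lo\<^sub>2 + a) (hi\<^sub>1 + hi\<^sub>2 + b) (f s'' t)"
      by auto
    then show ?thesis
      using left[of 1 s' t] I' that by blast
  qed
  from turn.prems(1,2) show ?case
  proof induction
    case (final t)
    show ?case
    proof (rule forces.turn)
      show "mv\<^sub>3 (- 1) (f s t) (f s\<^sub>0 t)"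
        using left turn.hyps(1) final by blast
      fix r assume "mv\<^sub>3 (- 1) (f s t) r"
      then obtain s' where "mv\<^sub>1 (- 1) s s'" "r = f s' t"
        using split[of "- 1" s t r] final by blast
      with goal show "\<exists>s'. mv\<^sub>3 1 r s' \<and> forces mv\<^sub>3 v\<^sub>3 (lo\<^sub>1 + lo\<^sub>2 + a) (hi\<^sub>1 + hi\<^sub>2 + b) s'"
        using final forces.final[of mv\<^sub>2 t lo\<^sub>2 v\<^sub>2 hi\<^sub>2] by blast
    qed
  next
    case (turn t t\<^sub>0)
    \<comment> \<open>The inner induction has taken the second strategy apart; it is reassembled
      because \<open>goal\<close> needs it intact.\<close>
    have f2: "forces mv\<^sub>2 v\<^sub>2 lo\<^sub>2 hi\<^sub>2 t"
      by (rule forces.turn, rule turn.hyps(1), drule turn.IH, blast)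
    show ?case
    proof (rule forces.turn)
      show "mv\<^sub>3 (- 1) (f s t) (f s t\<^sub>0)"
        using right turn by blast
      fix r assume r: "mv\<^sub>3 (- 1) (f s t) r"
      show "\<exists>s'. mv\<^sub>3 1 r s' \<and> forces mv\<^sub>3 v\<^sub>3 (lo\<^sub>1 + lo\<^sub>2 + a) (hi\<^sub>1 + hi\<^sub>2 + b) s'"
      proof (cases "\<exists>s'. mv\<^sub>1 (- 1) s s' \<and> r = f s' t")
        case True
        then show ?thesis using goal f2 turn.prems by blast
      next
        case False
        then obtain t' where t': "mv\<^sub>2 (- 1) t t'" "r = f s t'"
          using split[of "- 1" s t r] r turn.prems by blast
        then have I': "I s t'" using right[of "- 1"] turn.prems by blast
        from turn.IH[OF t'(1)] turn.prems obtain t'' where "mv\<^sub>2 1 t' t''"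
          and "I s t'' \<Longrightarrow> forces mv\<^sub>3 v\<^sub>3 (lo\<^sub>1 + lo\<^sub>2 + a) (hi\<^sub>1 + hi\<^sub>2 + b) (f s t'')"
          by auto
        then show ?thesis
          using right[of 1 s t'] I' t'(2) by blast
      qed
    qed
  qed
qed

text \<open>Transfer along a map that may identify positions: moves of the opponent are pushed
  forward along \<open>f\<close>, replies are pulled back. The values have to agree in finished
  positions only.\<close>

lemma forces_simulate:
  assumes "forces mv\<^sub>2 v\<^sub>2 lo hi (f s)" and "I s"
    and opp: "\<And>s s'. I s \<Longrightarrow> mv\<^sub>1 (- 1) s s' \<Longrightarrow> mv\<^sub>2 (- 1) (f s) (f s') \<and> I s'"
    and opp': "\<And>s t. I s \<Longrightarrow> mv\<^sub>2 (- 1) (f s) t \<Longrightarrow> \<exists>s'. mv\<^sub>1 (- 1) s s'"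
    and me: "\<And>s t. I s \<Longrightarrow> mv\<^sub>2 1 (f s) t \<Longrightarrow> \<exists>s'. mv\<^sub>1 1 s s' \<and> t = f s' \<and> I s'"
    and v: "\<And>s. I s \<Longrightarrow> (\<And>t. \<not> mv\<^sub>1 (- 1) s t) \<Longrightarrow> v\<^sub>1 s = v\<^sub>2 (f s)"
  shows "forces mv\<^sub>1 v\<^sub>1 lo hi s"
  using assms(1,2)
proof (induction "f s" arbitrary: s)
  case final
  then have no: "\<not> mv\<^sub>1 (- 1) s t" for t using opp by blast
  show ?case
    by (rule forces.final) (use no v[of s] final in auto)
next
  case (turn t\<^sub>0)
  obtain s\<^sub>0 where "mv\<^sub>1 (- 1) s s\<^sub>0" using turn opp' by blast
  then show ?case
  proof (rule forces.turn)
    fix t assume "mv\<^sub>1 (- 1) s t"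
    then have "mv\<^sub>2 (- 1) (f s) (f t)" "I t" using opp turn by blast+
    then show "\<exists>s'. mv\<^sub>1 1 t s' \<and> forces mv\<^sub>1 v\<^sub>1 lo hi s'"
      using turn(2)[of "f t"] me[of t] by blast
  qed
qed

section \<open>Words and their gaps\<close>

definition fill :: "int \<Rightarrow> int list \<Rightarrow> int list \<Rightarrow> bool" where
  "fill x w w' \<longleftrightarrow> (\<exists>u v. w = u @ 0 # v \<and> w' = u @ x # v)"

fun score :: "int list \<Rightarrow> int" where
  "score (x # y # w) = score (y # w) - x * y"
| "score _ = 0"

abbreviation holds :: "int \<Rightarrow> int \<Rightarrow> int list \<Rightarrow> bool" where
  "holds \<equiv> forces fill score"

lemma ex_fill: "(\<exists>w'. fill x w w') \<longleftrightarrow> 0 \<in> set w"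
  by (auto simp: fill_def dest: split_list)

lemma fill_set: "fill x w w' \<Longrightarrow> set w' \<subseteq> insert x (set w)"
  by (auto simp: fill_def)

lemma append_eq_append_Cons_iff:
  "u @ v = p @ a # q \<longleftrightarrow> (\<exists>q'. u = p @ a # q' \<and> q = q' @ v) \<or> (\<exists>p'. p = u @ p' \<and> v = p' @ a # q)"
  by (induction u arbitrary: p) (force simp: Cons_eq_append_conv)+

lemma fill_append:
  "fill x (u @ v) w \<longleftrightarrow> (\<exists>u'. fill x u u' \<and> w = u' @ v) \<or> (\<exists>v'. fill x v v' \<and> w = u @ v')"
  (is "?L \<longleftrightarrow> ?R")
proof
  assume ?L
  then obtain p q where "u @ v = p @ 0 # q" "w = p @ x # q" by (auto simp: fill_def)
  then show ?R by (fastforce simp: fill_def append_eq_append_Cons_iff)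
next
  assume ?R
  then consider p q where "u = p @ 0 # q" "w = p @ x # q @ v" | p q where "v = p @ 0 # q" "w = u @ p @ x # q"
    by (auto simp: fill_def)
  then show ?L
  proof cases
    case 1
    then show ?thesis unfolding fill_def by (intro exI[of _ p] exI[of _ "q @ v"]) simp
  next
    case 2
    then show ?thesis unfolding fill_def by (intro exI[of _ "u @ p"] exI[of _ q]) simp
  qed
qed

lemma score_append:
  assumes "u \<noteq> []" "v \<noteq> []"
  shows "score (u @ v) = score u + score v - last u * hd v"
  using assms(1)
proof (induction u rule: score.induct)
  case ("2_2" x)
  then show ?case using assms(2) by (cases v) auto
qed auto

lemma abs_mult_cells: "x \<in> {- 1, 0, 1} \<Longrightarrow> y \<in> {- 1, 0, 1} \<Longrightarrow> x * y \<in> {- 1, 0, 1 :: int}"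
  by auto

lemma score_append_bounds:
  assumes "set u \<subseteq> {- 1, 0, 1}" "set v \<subseteq> {- 1, 0, 1}"
  shows "score u + score v - 1 \<le> score (u @ v)" "score (u @ v) \<le> score u + score v + 1"
proof -
  have "score u + score v - 1 \<le> score (u @ v) \<and> score (u @ v) \<le> score u + score v + 1"
  proof (cases "u = [] \<or> v = []")
    case False
    then have "last u \<in> set u" "hd v \<in> set v" by auto
    then have "last u * hd v \<in> {- 1, 0, 1}"
      using assms by (intro abs_mult_cells) blast+
    with False show ?thesis by (auto simp: score_append)
  qed auto
  then show "score u + score v - 1 \<le> score (u @ v)" "score (u @ v) \<le> score u + score v + 1" by auto
qed

text \<open>Neither strategy controls the edge at the junction, so it is charged in full at both
  ends of the interval.\<close>

lemma holds_append:
  assumes "holds lo\<^sub>1 hi\<^sub>1 u" "holds lo\<^sub>2 hi\<^sub>2 v"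
    and "set u \<subseteq> {- 1, 0, 1}" "set v \<subseteq> {- 1, 0, 1}"
  shows "holds (lo\<^sub>1 + lo\<^sub>2 - 1) (hi\<^sub>1 + hi\<^sub>2 + 1) (u @ v)"
proof -
  have "holds (lo\<^sub>1 + lo\<^sub>2 + - 1) (hi\<^sub>1 + hi\<^sub>2 + 1) (u @ v)"
  proof (rule forces_sum[where f = "(@)" and I = "\<lambda>u v. set u \<subseteq> {- 1, 0, 1} \<and> set v \<subseteq> {- 1, 0, 1}",
        OF assms(1,2)])
    fix x :: int and s s' t t' :: "int list"
    assume *: "x \<in> {- 1, 1}" "set s \<subseteq> {- 1, 0, 1} \<and> set t \<subseteq> {- 1, 0, 1}"
    show "fill x (s @ t) (s' @ t) \<and> set s' \<subseteq> {- 1, 0, 1} \<and> set t \<subseteq> {- 1, 0, 1}" if "fill x s s'"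
      using * that fill_set[OF that] by (auto simp: fill_append)
    show "fill x (s @ t) (s @ t') \<and> set s \<subseteq> {- 1, 0, 1} \<and> set t' \<subseteq> {- 1, 0, 1}" if "fill x t t'"
      using * that fill_set[OF that] by (auto simp: fill_append)
  qed (use assms(3,4) score_append_bounds in \<open>auto simp: fill_append\<close>)
  then show ?thesis by simp
qed

text \<open>A gap is a maximal run of blanks: the unordered labels of its two neighbours, and its length. A
  missing neighbour at an end of the path counts as 0, so that the missing edge contributes nothing.\<close>

type_synonym gap = "int multiset \<times> nat"

inductive cut :: "int \<Rightarrow> gap multiset \<Rightarrow> gap multiset \<Rightarrow> bool" for x where
  "cut x (add_mset ({#b, c#}, i + Suc j) M) (add_mset ({#b, x#}, i) (add_mset ({#x, c#}, j) M))"

text \<open>The length is ignored: the value is meant for finished positions, where every gap has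
  length 0 and so is an edge with both ends labelled, or a missing edge at an end of the
  path.\<close>

definition total :: "gap multiset \<Rightarrow> int" where
  "total M = - (\<Sum>(B, l)\<in>#M. prod_mset B)"

lemma total_simps [simp]:
  "total {#} = 0"
  "total (add_mset (B, l) M) = total M - prod_mset B"
  "total (M + N) = total M + total N"
  by (auto simp: total_def)

lemma cut_add_right: "cut x M M' \<Longrightarrow> cut x (M + N) (M' + N)"
  by (induction rule: cut.induct) (metis (no_types) cut.intros union_mset_add_mset_left)

lemma cut_add_left: "cut x M M' \<Longrightarrow> cut x (N + M) (N + M')"
  using cut_add_right[of x M M' N] by (simp add: add.commute)

lemma cut_add_mset_iff:
  "cut x (add_mset s M) N \<longleftrightarrow>
    (\<exists>b c i j. s = ({#b, c#}, i + Suc j) \<and> N = add_mset ({#b, x#}, i) (add_mset ({#x, c#}, j) M)) \<or>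
    (\<exists>M'. cut x M M' \<and> N = add_mset s M')"
  (is "?L \<longleftrightarrow> ?R")
proof
  assume ?L
  then obtain b c i j M\<^sub>0 where eq: "add_mset s M = add_mset ({#b, c#}, i + Suc j) M\<^sub>0"
    and N: "N = add_mset ({#b, x#}, i) (add_mset ({#x, c#}, j) M\<^sub>0)"
    by (cases rule: cut.cases) blast
  show ?R
  proof (cases "s = ({#b, c#}, i + Suc j)")
    case True
    then show ?thesis using eq N by auto
  next
    case False
    then obtain K where K: "M = add_mset ({#b, c#}, i + Suc j) K" "M\<^sub>0 = add_mset s K"
      using eq by (auto simp: add_eq_conv_ex)
    then have "cut x M (add_mset ({#b, x#}, i) (add_mset ({#x, c#}, j) K))"
      by (simp only: cut.intros)
    moreover have "N = add_mset s (add_mset ({#b, x#}, i) (add_mset ({#x, c#}, j) K))"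
      using N K by (simp add: add_mset_commute)
    ultimately show ?thesis by blast
  qed
next
  assume ?R
  then show ?L
    using cut_add_left[of x M _ "{#s#}"] cut.intros[of x] by fastforce
qed

lemma not_cut_empty [simp]: "\<not> cut x {#} N"
  by (auto elim: cut.cases)

lemma cut_plus_iff:
  "cut x (M + N) K \<longleftrightarrow> (\<exists>M'. cut x M M' \<and> K = M' + N) \<or> (\<exists>N'. cut x N N' \<and> K = M + N')"
proof (induction M arbitrary: K)
  case (add s M)
  define here where "here M K \<longleftrightarrow> (\<exists>b c i j. s = ({#b, c#}, i + Suc j) \<and>
    K = add_mset ({#b, x#}, i) (add_mset ({#x, c#}, j) M))" for M K
  have iff: "cut x (add_mset s M) K \<longleftrightarrow> here M K \<or> (\<exists>M'. cut x M M' \<and> K = add_mset s M')" for M K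
    unfolding cut_add_mset_iff here_def ..
  have "here (M + N) K \<longleftrightarrow> (\<exists>M'. here M M' \<and> K = M' + N)"
  proof
    assume "here (M + N) K"
    then obtain b c i j where *: "s = ({#b, c#}, i + Suc j)"
      "K = add_mset ({#b, x#}, i) (add_mset ({#x, c#}, j) M) + N"
      unfolding here_def by auto
    then have "here M (add_mset ({#b, x#}, i) (add_mset ({#x, c#}, j) M))"
      unfolding here_def by blast
    with * show "\<exists>M'. here M M' \<and> K = M' + N" by blast
  next
    assume "\<exists>M'. here M M' \<and> K = M' + N"
    then show "here (M + N) K" unfolding here_def by force
  qed
  then show ?case
    unfolding union_mset_add_mset_left iff add by (auto; blast)
qed auto

abbreviation secures :: "int \<Rightarrow> int \<Rightarrow> gap multiset \<Rightarrow> bool" where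
  "secures \<equiv> forces cut total"

text \<open>No edge runs between two gaps, so \<open>total\<close> is additive and, unlike in
  \<open>holds_append\<close>, nothing is lost.\<close>

lemma secures_plus:
  assumes "secures lo\<^sub>1 hi\<^sub>1 M" "secures lo\<^sub>2 hi\<^sub>2 N"
  shows "secures (lo\<^sub>1 + lo\<^sub>2) (hi\<^sub>1 + hi\<^sub>2) (M + N)"
  using forces_sum[where f = "(+)" and I = "\<lambda>_ _. True" and a = 0 and b = 0 and mv\<^sub>3 = cut and v\<^sub>3 = total,
      OF assms] by (auto simp: cut_plus_iff)

text \<open>A scan from the left: \<open>b\<close> is the last label met and \<open>l\<close> counts
  the blanks since. Starting with \<open>b = 0\<close> encodes the missing left neighbour.\<close>

fun gaps :: "int \<Rightarrow> nat \<Rightarrow> int list \<Rightarrow> gap multiset" where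
  "gaps b l [] = {#({#b, 0#}, l)#}"
| "gaps b l (x # w) = (if x = 0 then gaps b (Suc l) w else add_mset ({#b, x#}, l) (gaps x 0 w))"

text \<open>The state of the scan reaches only the first gap it produces. Uniformity in
  \<open>b\<close> and \<open>l\<close> lets \<open>gaps_fill\<close> compare the scans of one
  suffix before and after a move.\<close>

lemma gaps_shift: "\<exists>m c M. \<forall>b l. gaps b l v = add_mset ({#b, c#}, l + m) M"
proof (induction v)
  case Nil
  then show ?case by auto
next
  case (Cons x v)
  then obtain m c M where *: "\<And>b l. gaps b l v = add_mset ({#b, c#}, l + m) M" by blast
  show ?case
  proof (cases "x = 0")
    case True
    then show ?thesis by (intro exI[of _ "Suc m"] exI[of _ c] exI[of _ M]) (simp add: *)
  next
    case False
    then show ?thesis by (intro exI[of _ 0] exI[of _ x] exI[of _ "gaps x 0 v"]) simp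
  qed
qed

lemma gaps_fill:
  assumes "x \<noteq> 0"
  shows "cut x (gaps b l (u @ 0 # v)) (gaps b l (u @ x # v))"
proof (induction u arbitrary: b l)
  case Nil
  obtain m c M where "\<And>b l. gaps b l v = add_mset ({#b, c#}, l + m) M"
    using gaps_shift by blast
  then show ?case using assms cut.intros[of x b c l m M] by simp
next
  case (Cons y u)
  then show ?case using cut_add_left[of x _ _ "{#({#b, y#}, l)#}"] by auto
qed

lemma gaps_replicate: "gaps b l (replicate m 0 @ w) = gaps b (l + m) w"
  by (induction m arbitrary: l) auto

lemma pair_eq_iff: "{#a, b#} = {#c, d#} \<longleftrightarrow> a = c \<and> b = d \<or> a = d \<and> b = c"
  by (auto simp: add_eq_conv_ex)

text \<open>The converse of \<open>gaps_fill\<close>. Gaps forget their orientation, so a cut into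
  lengths \<open>i\<close> and \<open>j\<close> may have to be realised in mirror image, at offset
  \<open>j\<close>.\<close>

lemma cut_gaps:
  assumes "x \<noteq> 0" "cut x (gaps b 0 w) N"
  shows "\<exists>u v. w = u @ 0 # v \<and> N = gaps b 0 (u @ x # v)"
  using assms(2)
proof (induction w arbitrary: b N rule: length_induct)
  case (1 w)
  \<comment> \<open>The leading blanks form the first gap. Either the cut hits it, or the induction
    continues behind the first label.\<close>
  define m where "m = length (takeWhile (\<lambda>y. y = 0) w)"
  define r where "r = dropWhile (\<lambda>y. y = 0) w"
  have tw: "takeWhile (\<lambda>y. y = 0) w = replicate m 0"
    unfolding m_def by (intro replicate_eqI) (auto dest: set_takeWhileD)
  have w: "w = replicate m 0 @ r"
    unfolding r_def tw[symmetric] by simp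
  have hd: "r = y # w' \<Longrightarrow> y \<noteq> 0" for y w'
    unfolding r_def by (auto simp: dropWhile_eq_Cons_conv)
  have split: "\<exists>u v. w = u @ 0 # v \<and> N = gaps b 0 (u @ x # v)"
    if g: "\<And>l b. gaps b l r = add_mset ({#b, c#}, l) M" and m: "m = i + Suc j"
      and N: "N = add_mset ({#b, x#}, i) (add_mset ({#x, c#}, j) M)" for c M i j
  proof (intro exI conjI)
    have "replicate m (0::int) = replicate i 0 @ 0 # replicate j 0"
      by (simp add: m flip: replicate_Suc replicate_add)
    then show "w = replicate i 0 @ 0 # (replicate j 0 @ r)" using w by simp
    show "N = gaps b 0 (replicate i 0 @ x # (replicate j 0 @ r))"
      using assms(1) by (simp add: gaps_replicate g N)
  qed
  have first: "\<exists>u v. w = u @ 0 # v \<and> N = gaps b 0 (u @ x # v)"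
    if g: "\<And>l b. gaps b l r = add_mset ({#b, c#}, l) M"
      and s: "({#b, c#}, m) = ({#b', c'#}, i + Suc j)"
      and N: "N = add_mset ({#b', x#}, i) (add_mset ({#x, c'#}, j) M)" for c M b' c' i j
  proof -
    consider "b = b'" "c = c'" | "b = c'" "c = b'" using s by (auto simp: pair_eq_iff)
    then show ?thesis
    proof cases
      case 1
      then show ?thesis using split[OF g, of i j] s N by auto
    next
      case 2
      then show ?thesis using split[OF g, of j i] s N
        by (auto simp: add_mset_commute)
    qed
  qed
  show ?case
  proof (cases r)
    case Nil
    then have g: "\<And>l b. gaps b l r = add_mset ({#b, 0#}, l) {#}" by simp
    have "cut x (add_mset ({#b, 0#}, m) {#}) N"
      using 1(2) gaps_replicate[of b 0 m "[]"] by (simp add: w Nil)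
    then obtain b' c' i j where "({#b, 0#}, m) = ({#b', c'#}, i + Suc j)"
      "N = add_mset ({#b', x#}, i) (add_mset ({#x, c'#}, j) {#})"
      unfolding cut_add_mset_iff using not_cut_empty by blast
    then show ?thesis using first[OF g] by blast
  next
    case (Cons y w')
    have y: "y \<noteq> 0" using hd Cons by blast
    then have g: "\<And>l b. gaps b l r = add_mset ({#b, y#}, l) (gaps y 0 w')" using Cons by simp
    have "cut x (add_mset ({#b, y#}, m) (gaps y 0 w')) N"
      using 1(2) y by (simp add: w gaps_replicate Cons)
    then consider (a) b' c' i j where "({#b, y#}, m) = ({#b', c'#}, i + Suc j)"
      "N = add_mset ({#b', x#}, i) (add_mset ({#x, c'#}, j) (gaps y 0 w'))"
      | (b) N' where "cut x (gaps y 0 w') N'" "N = add_mset ({#b, y#}, m) N'"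
      unfolding cut_add_mset_iff by blast
    then show ?thesis
    proof cases
      case a
      then show ?thesis using first[OF g] by blast
    next
      case b
      have "length w' < length w" by (simp add: w Cons)
      then obtain u v where uv: "w' = u @ 0 # v" "N' = gaps y 0 (u @ x # v)"
        using 1(1) b(1) by blast
      show ?thesis
      proof (intro exI conjI)
        show "w = (replicate m 0 @ y # u) @ 0 # v" by (simp add: w Cons uv)
        show "N = gaps b 0 ((replicate m 0 @ y # u) @ x # v)"
          using y by (simp add: gaps_replicate b uv)
      qed
    qed
  qed
qed

text \<open>Without blanks each gap is one edge, except the last, whose missing neighbour 0 makes
  its product vanish.\<close>

lemma total_gaps: "0 \<notin> set w \<Longrightarrow> total (gaps b l w) = score (b # w)"
  by (induction w arbitrary: b l) auto

lemma score_0_Cons: "score (0 # w) = score w"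
  by (cases w) auto

lemma secures_imp_holds:
  assumes "secures lo hi (gaps 0 0 w)"
  shows "holds lo hi w"
proof (rule forces_simulate[where f = "gaps 0 0" and I = "\<lambda>_. True", OF assms])
  fix s s' assume "fill (- 1) s s'"
  then show "cut (- 1) (gaps 0 0 s) (gaps 0 0 s') \<and> True"
    by (auto simp: fill_def gaps_fill)
next
  fix s t assume "cut (- 1) (gaps 0 0 s) t"
  then show "\<exists>s'. fill (- 1) s s'"
    using cut_gaps[of "- 1" 0 s t] by (auto simp: fill_def)
next
  fix s t assume "cut 1 (gaps 0 0 s) t"
  then show "\<exists>s'. fill 1 s s' \<and> t = gaps 0 0 s' \<and> True"
    using cut_gaps[of 1 0 s t] by (auto simp: fill_def)
next
  fix s assume "\<And>t. \<not> fill (- 1) s t"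
  then have "0 \<notin> set s" using ex_fill by blast
  then show "score s = total (gaps 0 0 s)"
    by (simp add: total_gaps score_0_Cons)
qed auto

section \<open>Verifying strategies on lists of segments\<close>

text \<open>An oriented gap: left neighbour, length, right neighbour. Moves on a list of these can
  be enumerated by evaluation.\<close>

type_synonym segment = "int \<times> int \<times> int"

fun gap_of :: "segment \<Rightarrow> gap" where
  "gap_of (b, l, c) = ({#b, c#}, nat l)"

definition safe :: "segment list \<Rightarrow> int \<Rightarrow> int \<Rightarrow> bool" where
  "safe P lo hi \<longleftrightarrow> secures lo hi (image_mset gap_of (mset P))"

fun picks :: "'a list \<Rightarrow> ('a \<times> 'a list) list" where
  "picks [] = []"
| "picks (s # P) = (s, P) # map (apsnd (Cons s)) (picks P)"

lemma mset_picks: "(s, R) \<in> set (picks P) \<Longrightarrow> mset P = add_mset s (mset R)"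
  by (induction P arbitrary: R) auto

lemma ex_picks: "s \<in> set P \<Longrightarrow> \<exists>R. (s, R) \<in> set (picks P)"
proof (induction P)
  case (Cons t P)
  show ?case
  proof (cases "s = t")
    case False
    with Cons obtain R where "(s, R) \<in> set (picks P)" by auto
    then have "apsnd (Cons t) (s, R) \<in> set (picks (t # P))" by (simp only: picks.simps set_simps set_map) blast
    then show ?thesis by auto
  qed auto
qed simp

text \<open>The halves of the split segment are put in front; \<open>respond\<close> relies on
  finding them there.\<close>

definition cuts :: "int \<Rightarrow> segment list \<Rightarrow> segment list list" where
  "cuts x P = concat (map (\<lambda>((b, l, c), R). map (\<lambda>i. (b, i, x) # (x, l - 1 - i, c) # R) [0..l - 1]) (picks P))"

lemma cut_segment:
  assumes "mset P = add_mset (b, l, c) (mset R)" "0 \<le> i" "i < l"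
  shows "cut x (image_mset gap_of (mset P)) (image_mset gap_of (mset ((b, i, x) # (x, l - 1 - i, c) # R)))"
proof -
  have "nat l = nat i + Suc (nat (l - 1 - i))" using assms by simp
  with assms(1) cut.intros[of x b c "nat i" "nat (l - 1 - i)"] show ?thesis by simp
qed

text \<open>Needed for the opponent, none of whose moves may be missed. The orientation of the gap
  can disagree with that of the stored segment, hence the position \<open>int j\<close> in the
  second case.\<close>

lemma cuts_complete:
  assumes "cut x (image_mset gap_of (mset P)) N"
  shows "\<exists>Q\<in>set (cuts x P). N = image_mset gap_of (mset Q)"
  using assms
proof cases
  case (1 b' c' i j M)
  from msed_map_invR[OF 1(1)] obtain s M' where s: "mset P = add_mset s M'"
    "gap_of s = ({#b', c'#}, i + Suc j)" "image_mset gap_of M' = M" by blast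
  obtain b l c where bc: "s = (b, l, c)" using prod_cases3 by blast
  have "s \<in> set P" using s(1) by (metis set_mset_mset union_single_eq_member)
  then obtain R where R: "(s, R) \<in> set (picks P)" using ex_picks by metis
  with s(1) have M': "M' = mset R" using mset_picks by fastforce
  have l: "l = int i + 1 + int j" using s(2) bc by auto
  have mem: "(b, k, x) # (x, l - 1 - k, c) # R \<in> set (cuts x P)" if "0 \<le> k" "k < l" for k
    using that unfolding cuts_def set_concat set_map image_image
    by (intro UN_I[OF R[unfolded bc]]) simp
  from s(2) bc consider "b = b'" "c = c'" | "b = c'" "c = b'" by (auto simp: pair_eq_iff)
  then show ?thesis
  proof cases
    case 1
    then show ?thesis using l \<open>N = _\<close> s(3) M' by (intro bexI[OF _ mem[of "int i"]]) auto
  next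
    case 2
    then show ?thesis using l \<open>N = _\<close> s(3) M'
      by (intro bexI[OF _ mem[of "int j"]]) (auto simp: add_mset_commute)
  qed
qed

lemma cuts_sound:
  "Q \<in> set (cuts x P) \<Longrightarrow> cut x (image_mset gap_of (mset P)) (image_mset gap_of (mset Q))"
  unfolding cuts_def using cut_segment[OF mset_picks] by fastforce

lemma safe_step:
  assumes "cuts (- 1) P \<noteq> []"
    and "\<And>Q. Q \<in> set (cuts (- 1) P) \<Longrightarrow>
      \<exists>R. cut 1 (image_mset gap_of (mset Q)) (image_mset gap_of (mset R)) \<and> safe R lo hi"
  shows "safe P lo hi"
  unfolding safe_def
proof (rule forces.turn)
  have "hd (cuts (- 1) P) \<in> set (cuts (- 1) P)" using assms(1) by simp
  then show "cut (- 1) (image_mset gap_of (mset P)) (image_mset gap_of (mset (hd (cuts (- 1) P))))"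
    by (rule cuts_sound)
next
  fix N assume "cut (- 1) (image_mset gap_of (mset P)) N"
  then obtain Q where "Q \<in> set (cuts (- 1) P)" and N: "N = image_mset gap_of (mset Q)"
    using cuts_complete by blast
  from assms(2)[OF this(1)] show "\<exists>s'. cut 1 N s' \<and> secures lo hi s'"
    unfolding safe_def N by blast
qed

lemma safe_Nil: "safe [] lo hi \<longleftrightarrow> lo \<le> 0 \<and> 0 \<le> hi"
  unfolding safe_def
  by (subst forces.simps) auto

lemma safe_weaken: "safe P lo hi \<Longrightarrow> lo' \<le> lo \<Longrightarrow> hi \<le> hi' \<Longrightarrow> safe P lo' hi'"
  unfolding safe_def by (rule forces_weaken)

lemma safe_append: "safe P lo hi \<Longrightarrow> safe Q lo' hi' \<Longrightarrow> safe (P @ Q) (lo + lo') (hi + hi')"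
  unfolding safe_def using secures_plus by simp

lemma safe_cong:
  "image_mset gap_of (mset P) = image_mset gap_of (mset Q) \<Longrightarrow> safe P lo hi \<longleftrightarrow> safe Q lo hi"
  by (simp add: safe_def)

lemma safe_closed: "safe [(b, 0, c)] (- (b * c)) (- (b * c))"
  unfolding safe_def by (intro forces.final) (auto elim: cut.cases)

lemma safe_closed_Cons: "safe P (lo + b * c) (hi + b * c) \<Longrightarrow> safe ((b, 0, c) # P) lo hi"
  using safe_append[OF safe_closed[of b c], of P "lo + b * c" "hi + b * c"] by simp

lemma safe_cuts:
  assumes "cuts (- 1) P \<noteq> []" "\<forall>Q\<in>set (cuts (- 1) P). \<exists>R\<in>set (cuts 1 Q). safe R lo hi"
  shows "safe P lo hi"
  by (rule safe_step[OF assms(1)]) (use assms(2) cuts_sound in blast)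

text \<open>The reply takes the other blank, which gives \<open>b, - 1, 1, b\<close> or its mirror
  image: the outer edges cancel and the middle one counts 1.\<close>

lemma safe_two: "safe [(b, 2, b)] 1 1"
proof (rule safe_cuts)
  show "cuts (- 1) [(b, 2, b)] \<noteq> []" by (simp add: cuts_def upto_rec1)
  have "safe [(- 1, 0, 1), (1, 0, b), (b, 0, - 1)] 1 1" "safe [(b, 0, 1), (1, 0, - 1), (- 1, 0, b)] 1 1"
    by (intro safe_closed_Cons; simp add: safe_Nil)+
  then show "\<forall>Q\<in>set (cuts (- 1) [(b, 2, b)]). \<exists>R\<in>set (cuts 1 Q). safe R 1 1"
    by (simp add: cuts_def upto_rec1)
qed

text \<open>The reply goes to the other copy. The copy with \<open>- 1\<close> contributes
  \<open>b + c\<close>, the one with \<open>1\<close> contributes \<open>- (b + c)\<close>.\<close>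

lemma safe_one_one: "safe [(b, 1, c), (b, 1, c)] 0 0"
proof (rule safe_cuts)
  show "cuts (- 1) [(b, 1, c), (b, 1, c)] \<noteq> []" by (simp add: cuts_def upto_rec1)
  have "safe [(b, 0, 1), (1, 0, c), (b, 0, - 1), (- 1, 0, c)] 0 0"
    by (intro safe_closed_Cons; simp add: safe_Nil)
  then show "\<forall>Q\<in>set (cuts (- 1) [(b, 1, c), (b, 1, c)]). \<exists>R\<in>set (cuts 1 Q). safe R 0 0"
    by (simp add: cuts_def upto_rec1)
qed

text \<open>Sorting by length and then by labels makes a position match its recorded claim
  syntactically. An equal partner of length 1 is deleted together with the new segment, by
  \<open>safe_one_one\<close>.\<close>

fun insert_segment :: "segment \<Rightarrow> segment list \<Rightarrow> segment list" where
  "insert_segment s [] = [s]"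
| "insert_segment (b, l, c) ((b', l', c') # Q) =
    (if l = 1 \<and> l' = 1 \<and> b = b' \<and> c = c' then Q
     else if l < l' \<or> l = l' \<and> (b < b' \<or> b = b' \<and> c \<le> c') then (b, l, c) # (b', l', c') # Q
     else (b', l', c') # insert_segment (b, l, c) Q)"

lemma mset_insert_segment:
  "mset (insert_segment s Q) = add_mset s (mset Q) \<or>
    (\<exists>b c. s = (b, 1, c) \<and> mset Q = add_mset s (mset (insert_segment s Q)))"
  by (induction s Q rule: insert_segment.induct) auto

lemma safe_insert_segment:
  assumes "safe (P @ insert_segment s Q) lo hi"
  shows "safe (P @ s # Q) lo hi"
proof -
  from mset_insert_segment[of s Q] consider "mset (insert_segment s Q) = add_mset s (mset Q)"
    | b c where "s = (b, 1, c)" "mset Q = add_mset s (mset (insert_segment s Q))"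
    by blast
  then show ?thesis
  proof cases
    case 1
    then show ?thesis using assms safe_cong[of "P @ insert_segment s Q" "P @ s # Q"] by simp
  next
    case 2
    have "safe ([s, s] @ P @ insert_segment s Q) lo hi"
      using safe_append[OF safe_one_one assms, of b c] 2(1) by simp
    then show ?thesis
      using 2(2) safe_cong[of "[s, s] @ P @ insert_segment s Q" "P @ s # Q"] by simp
  qed
qed

text \<open>In canonical positions closed segments, two blanks between equal neighbours (value 1) and pairs of
  equal segments of length 1 (value 0) have been traded for the exact value that the replying player
  can enforce on them.\<close>

fun settle :: "segment list \<Rightarrow> segment list \<Rightarrow> int \<Rightarrow> int \<Rightarrow> bool" where
  "settle [] Q lo hi = safe Q lo hi"
| "settle ((b, l, c) # P) Q lo hi =
    (if l = 0 then settle P Q (lo + b * c) (hi + b * c)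
     else if l = 2 \<and> b = c then settle P Q (lo - 1) (hi - 1)
     else settle P (insert_segment (if b \<le> c then (b, l, c) else (c, l, b)) Q) lo hi)"

text \<open>The interval is what the remaining segments still have to reach, so a removed value is
  subtracted from both ends; a closed segment is worth \<open>- (b * c)\<close>, hence the plus
  sign. Reversing a segment does not change its gap.\<close>

lemma settle_sound: "settle P Q lo hi \<Longrightarrow> safe (P @ Q) lo hi"
proof (induction P Q lo hi rule: settle.induct)
  case (2 b l c P Q lo hi)
  consider "l = 0" | "l = 2" "b = c" | "l \<noteq> 0" "\<not> (l = 2 \<and> b = c)" by blast
  then show ?case
  proof cases
    case 1
    then show ?thesis using 2 by (auto intro: safe_closed_Cons)
  next
    case 2
    then have "safe (P @ Q) (lo - 1) (hi - 1)" using "2.IH" "2.prems" by simp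
    then show ?thesis using safe_append[OF safe_two[of b], of "P @ Q" "lo - 1" "hi - 1"] 2 by simp
  next
    case 3
    define s where "s = (if b \<le> c then (b, l, c) else (c, l, b))"
    have "safe (P @ insert_segment s Q) lo hi"
      using 3 "2.IH"(3) "2.prems" unfolding s_def by simp
    then have "safe (P @ s # Q) lo hi" by (rule safe_insert_segment)
    moreover have "gap_of s = gap_of (b, l, c)" by (simp add: s_def add_mset_commute)
    ultimately show ?thesis
      using safe_cong[of "P @ s # Q" "((b, l, c) # P) @ Q"] by simp
  qed
qed simp

text \<open>\<open>k\<close> numbers the blanks left after the opponent's move, from 0 and through
  the whole list. The halves of the reply are kept apart from the rest so that
  \<open>respond\<close> can settle them.\<close>

fun answer :: "int \<Rightarrow> segment list \<Rightarrow> (segment list \<times> segment list) option" where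
  "answer k [] = None"
| "answer k ((b, l, c) # P) =
    (if 0 \<le> k \<and> k < l then Some ([(b, k, 1), (1, l - 1 - k, c)], P)
     else map_option (apsnd (Cons (b, l, c))) (answer (k - l) P))"

lemma answer_sound:
  "answer k P = Some (H, R) \<Longrightarrow> cut 1 (image_mset gap_of (mset P)) (image_mset gap_of (mset (H @ R)))"
proof (induction k P arbitrary: H R rule: answer.induct)
  case (2 k b l c P)
  show ?case
  proof (cases "0 \<le> k \<and> k < l")
    case True
    with 2(2) cut_segment[of "(b, l, c) # P" b l c P k 1] show ?thesis by auto
  next
    case False
    with 2 obtain R' where "answer (k - l) P = Some (H, R')" "R = (b, l, c) # R'" by auto
    with 2(1)[OF False this(1)] cut_add_left[of 1 _ _ "{#gap_of (b, l, c)#}"] show ?thesis by simp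
  qed
qed simp

text \<open>The opponent's move leaves its two halves in front; only these and the halves of the reply
  (not the rest, which is already canonical) have to be sorted in.\<close>

definition respond :: "int \<Rightarrow> segment list \<Rightarrow> int \<Rightarrow> int \<Rightarrow> bool" where
  "respond k Q lo hi = (case answer k Q of None \<Rightarrow> False
    | Some (H, R) \<Rightarrow> settle (H @ take 2 R) (drop 2 R) lo hi)"

text \<open>The list does not affect the meaning: it only tells the check of planI which blank answers each
  move of the opponent, in the order of cuts.\<close>

definition plan :: "int list \<Rightarrow> segment list \<Rightarrow> int \<Rightarrow> int \<Rightarrow> bool" where
  "plan ks = safe"

text \<open>\<open>list_all2\<close> pairs the recorded replies with the complete enumeration of the
  opponent's moves, so no move stays unanswered. All premises can be decided by rewriting.\<close>

lemma planI:
  assumes "ks \<noteq> []" "list_all2 (\<lambda>k Q. respond k Q lo hi) ks (cuts (- 1) P)"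
  shows "plan ks P lo hi"
  unfolding plan_def
proof (rule safe_step)
  show "cuts (- 1) P \<noteq> []" using assms by auto
  fix Q assume "Q \<in> set (cuts (- 1) P)"
  then obtain k where "respond k Q lo hi"
    using assms(2) by (metis in_set_conv_nth list_all2_conv_all_nth)
  then obtain H R where *: "answer k Q = Some (H, R)" "settle (H @ take 2 R) (drop 2 R) lo hi"
    unfolding respond_def by (auto split: option.splits)
  then have "safe (H @ R) lo hi" using settle_sound by fastforce
  then show "\<exists>R. cut 1 (image_mset gap_of (mset Q)) (image_mset gap_of (mset R)) \<and> safe R lo hi"
    using answer_sound[OF *(1)] by blast
qed

lemma plan_weaken: "plan ks P lo hi \<Longrightarrow> lo' \<le> lo \<Longrightarrow> hi \<le> hi' \<Longrightarrow> safe P lo' hi'"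
  unfolding plan_def by (rule safe_weaken)

lemma safe_replicate: "safe [(0, int n, 0)] lo hi \<Longrightarrow> holds lo hi (replicate n 0)"
  using gaps_replicate[of 0 0 n "[]"] by (intro secures_imp_holds) (simp add: safe_def)

section \<open>Strategies on short paths\<close>

text \<open>The positions below are closed under the listed replies, up to settle; they were found by a computer
  search. The number in a fact name is the total number of blanks. In the claims needed only for the
  lower bound 3 on 16 blanks, the upper end is the vacuous number of remaining edges.\<close>

lemma plan_2:
  "plan [0, 0] [(- 1, 1, - 1), (- 1, 1, 0)] (- 1) 1"
  "plan [0, 0] [(- 1, 1, - 1), (- 1, 1, 1)] (- 2) 2"
  "plan [0, 0] [(- 1, 1, 0), (- 1, 1, 1)] (- 1) 1"
  "plan [0, 0] [(- 1, 1, 0), (0, 1, 1)] (- 2) 2"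
  "plan [0, 0] [(- 1, 1, 0), (1, 1, 1)] (- 3) 3"
  "plan [0, 0] [(- 1, 1, 1), (0, 1, 1)] (- 1) 1"
  "plan [0, 0] [(- 1, 1, 1), (0, 1, 1)] (- 1) 3"
  "plan [0, 0] [(- 1, 1, 1), (1, 1, 1)] (- 2) 2"
  "plan [0, 0] [(0, 1, 1), (1, 1, 1)] (- 1) 1"
  "plan [0, 0] [(0, 1, 1), (1, 1, 1)] (- 1) 3"
  "plan [0, 0] [(- 1, 2, 0)] 0 2"
  "plan [0, 0] [(- 1, 2, 1)] (- 1) 3"
  "plan [0, 0] [(0, 2, 1)] 0 2"
  by (rule planI; simp add: respond_def cuts_def upto_rec1 safe_Nil)+

text \<open>Conditional rewrite rules for the next levels: the recorded replies disappear, and a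
  claim also covers every wider interval, such as may arise from the shifts in
  \<open>settle\<close>.\<close>

lemmas safe_2 = plan_2[THEN plan_weaken]

text \<open>A round uses up two blanks and \<open>settle\<close> removes further ones two at a time,
  so each level rests on the smaller even levels and on \<open>safe_Nil\<close>.\<close>

lemma plan_4:
  "plan [0, 0, 2, 2] [(- 1, 1, - 1), (- 1, 1, 0), (0, 1, 1), (1, 1, 1)] (- 2) 2"
  "plan [0, 2, 0, 2] [(- 1, 1, - 1), (- 1, 1, 0), (- 1, 2, 0)] (- 3) 1"
  "plan [0, 2, 0, 2] [(- 1, 1, - 1), (- 1, 1, 0), (- 1, 2, 1)] (- 4) 2"
  "plan [0, 0, 0, 0] [(- 1, 1, - 1), (- 1, 1, 0), (0, 2, 1)] (- 1) 3"
  "plan [0, 2, 0, 2] [(- 1, 1, - 1), (- 1, 1, 1), (- 1, 2, 1)] (- 3) 1"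
  "plan [1, 2, 1, 2] [(- 1, 1, - 1), (0, 1, 1), (- 1, 2, 0)] (- 1) 3"
  "plan [1, 2, 1, 2] [(- 1, 1, - 1), (0, 1, 1), (- 1, 2, 1)] (- 2) 2"
  "plan [1, 2, 1, 2] [(- 1, 1, - 1), (1, 1, 1), (- 1, 2, 1)] (- 1) 3"
  "plan [0, 0, 0, 0] [(- 1, 1, - 1), (- 1, 3, - 1)] (- 2) 2"
  "plan [0, 2, 0, 0] [(- 1, 1, - 1), (- 1, 3, 1)] 0 4"
  "plan [0, 2, 0, 0] [(- 1, 1, - 1), (- 1, 3, 1)] 0 6"
  "plan [0, 2, 0, 0] [(- 1, 1, - 1), (0, 3, 1)] (- 1) 5"
  "plan [0, 1, 0, 0] [(- 1, 1, - 1), (1, 3, 1)] (- 2) 2"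
  "plan [0, 2, 0, 2] [(- 1, 1, 0), (- 1, 1, 1), (- 1, 2, 0)] (- 1) 1"
  "plan [0, 2, 0, 2] [(- 1, 1, 0), (- 1, 1, 1), (- 1, 2, 1)] (- 2) 2"
  "plan [0, 2, 0, 2] [(- 1, 1, 0), (- 1, 1, 1), (0, 2, 1)] (- 3) 1"
  "plan [1, 2, 1, 2] [(- 1, 1, 0), (0, 1, 1), (- 1, 2, 1)] (- 1) 1"
  "plan [1, 2, 1, 2] [(- 1, 1, 0), (1, 1, 1), (0, 2, 1)] (- 1) 3"
  "plan [1, 0, 2, 0] [(- 1, 1, 0), (- 1, 3, - 1)] (- 3) 1"
  "plan [0, 2, 0, 0] [(- 1, 1, 0), (- 1, 3, 0)] 0 2"
  "plan [0, 2, 0, 0] [(- 1, 1, 0), (- 1, 3, 1)] (- 1) 3"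
  "plan [0, 2, 0, 0] [(- 1, 1, 0), (0, 3, 1)] 0 4"
  "plan [0, 1, 0, 0] [(- 1, 1, 0), (1, 3, 1)] (- 1) 1"
  "plan [0, 2, 0, 2] [(- 1, 1, 1), (0, 1, 1), (- 1, 2, 0)] (- 3) 1"
  "plan [0, 2, 0, 2] [(- 1, 1, 1), (0, 1, 1), (- 1, 2, 1)] (- 2) 2"
  "plan [1, 0, 2, 0] [(- 1, 1, 1), (- 1, 3, - 1)] 0 2"
  "plan [1, 0, 2, 0] [(- 1, 1, 1), (- 1, 3, 0)] (- 1) 1"
  "plan [0, 0, 0, 0] [(- 1, 1, 1), (- 1, 3, 1)] (- 2) 2"
  "plan [0, 1, 0, 0] [(- 1, 1, 1), (0, 3, 1)] (- 1) 1"
  "plan [0, 1, 0, 0] [(- 1, 1, 1), (1, 3, 1)] (- 2) 0"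
  "plan [0, 1, 0, 0] [(- 1, 1, 1), (1, 3, 1)] 0 2"
  "plan [0, 0, 0, 0] [(- 1, 1, 1), (1, 3, 1)] 0 6"
  "plan [0, 0, 0, 0] [(0, 1, 1), (1, 1, 1), (- 1, 2, 1)] (- 2) 4"
  "plan [1, 0, 2, 0] [(0, 1, 1), (- 1, 3, - 1)] (- 1) 1"
  "plan [1, 0, 2, 0] [(0, 1, 1), (- 1, 3, 0)] (- 4) 2"
  "plan [0, 0, 0, 0] [(0, 1, 1), (- 1, 3, 0)] 0 4"
  "plan [0, 0, 0, 0] [(0, 1, 1), (- 1, 3, 1)] (- 1) 3"
  "plan [0, 0, 0, 0] [(0, 1, 1), (0, 3, 1)] (- 2) 2"
  "plan [0, 1, 0, 0] [(0, 1, 1), (1, 3, 1)] (- 3) 1"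
  "plan [0, 1, 0, 0] [(0, 1, 1), (1, 3, 1)] (- 1) 1"
  "plan [1, 0, 2, 0] [(1, 1, 1), (- 1, 3, - 1)] (- 2) 2"
  "plan [0, 0, 0, 0] [(1, 1, 1), (- 1, 3, 0)] (- 1) 5"
  "plan [0, 0, 0, 0] [(1, 1, 1), (- 1, 3, 1)] 0 4"
  "plan [0, 2, 0, 2] [(- 1, 2, 0), (- 1, 2, 0)] (- 2) 2"
  "plan [0, 0, 0, 0] [(- 1, 2, 0), (0, 2, 1)] 0 4"
  "plan [0, 2, 0, 2] [(- 1, 2, 1), (- 1, 2, 1)] (- 2) 2"
  "plan [0, 0, 0, 0] [(- 1, 2, 1), (0, 2, 1)] (- 1) 5"
  "plan [0, 2, 0, 2] [(0, 2, 1), (0, 2, 1)] (- 2) 2"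
  "plan [0, 0, 0, 0] [(- 1, 4, - 1)] (- 1) 3"
  "plan [0, 2, 0, 1] [(- 1, 4, 0)] (- 2) 2"
  "plan [0, 0, 0, 0] [(- 1, 4, 0)] 0 4"
  "plan [0, 0, 0, 0] [(- 1, 4, 1)] 1 5"
  "plan [1, 2, 0, 1] [(0, 4, 0)] (- 1) 1"
  "plan [0, 0, 0, 0] [(0, 4, 1)] 0 4"
  "plan [0, 0, 0, 0] [(1, 4, 1)] (- 1) 3"
  by (rule planI; simp add: respond_def cuts_def upto_rec1 safe_Nil safe_2)+

lemmas safe_4 = plan_4[THEN plan_weaken]

lemma plan_6:
  "plan [2, 0, 2, 2, 0, 0] [(- 1, 1, - 1), (- 1, 1, 0), (- 1, 1, 1), (- 1, 3, 1)] (- 1) 3"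
  "plan [0, 0, 2, 1, 0, 0] [(- 1, 1, - 1), (- 1, 1, 0), (- 1, 1, 1), (0, 3, 1)] (- 2) 2"
  "plan [0, 2, 0, 4, 0, 4] [(- 1, 1, - 1), (- 1, 1, 0), (- 1, 2, 1), (- 1, 2, 1)] (- 5) 1"
  "plan [1, 3, 0, 4, 2, 4] [(- 1, 1, - 1), (- 1, 1, 0), (- 1, 2, 1), (0, 2, 1)] (- 2) 2"
  "plan [1, 1, 0, 2, 0, 1] [(- 1, 1, - 1), (- 1, 1, 0), (- 1, 4, 1)] (- 2) 2"
  "plan [3, 1, 1, 1, 1, 2] [(- 1, 1, - 1), (- 1, 1, 1), (0, 1, 1), (1, 1, 1), (- 1, 2, 1)] (- 2) 4"
  "plan [0, 3, 4, 0, 1, 4] [(- 1, 1, - 1), (- 1, 1, 1), (0, 1, 1), (- 1, 3, 0)] (- 2) 2"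
  "plan [0, 4, 1, 2, 4, 2] [(- 1, 1, - 1), (- 1, 1, 1), (- 1, 2, 0), (0, 2, 1)] (- 2) 2"
  "plan [0, 2, 0, 4, 0, 4] [(- 1, 1, - 1), (- 1, 1, 1), (- 1, 2, 1), (- 1, 2, 1)] (- 4) 0"
  "plan [0, 2, 0, 4, 0, 4] [(- 1, 1, - 1), (- 1, 1, 1), (- 1, 2, 1), (- 1, 2, 1)] (- 4) 2"
  "plan [0, 2, 0, 1, 0, 0] [(- 1, 1, - 1), (- 1, 1, 1), (- 1, 4, - 1)] (- 3) 1"
  "plan [0, 1, 0, 0, 0, 0] [(- 1, 1, - 1), (- 1, 1, 1), (- 1, 4, 1)] (- 1) 3"
  "plan [0, 1, 2, 0, 0, 0] [(- 1, 1, - 1), (- 1, 1, 1), (1, 4, 1)] (- 3) 1"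
  "plan [1, 2, 0, 2, 0, 2] [(- 1, 1, - 1), (0, 1, 1), (- 1, 2, 0), (- 1, 2, 1)] (- 2) 2"
  "plan [0, 2, 0, 4, 0, 4] [(- 1, 1, - 1), (0, 1, 1), (- 1, 2, 1), (- 1, 2, 1)] (- 5) 1"
  "plan [1, 2, 0, 1, 0, 0] [(- 1, 1, - 1), (0, 1, 1), (- 1, 4, - 1)] (- 2) 4"
  "plan [0, 1, 3, 0, 3, 0] [(- 1, 1, - 1), (0, 1, 1), (- 1, 4, 1)] (- 2) 4"
  "plan [1, 2, 0, 2, 0, 2] [(- 1, 1, - 1), (1, 1, 1), (- 1, 2, 1), (- 1, 2, 1)] (- 2) 2"
  "plan [2, 1, 1, 0, 1, 0] [(- 1, 1, - 1), (1, 1, 1), (1, 4, 1)] (- 1) 3"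
  "plan [0, 0, 2, 0, 0, 0] [(- 1, 1, - 1), (- 1, 2, 1), (- 1, 3, 1)] (- 1) 3"
  "plan [1, 0, 2, 1, 0, 0] [(- 1, 1, - 1), (- 1, 2, 1), (1, 3, 1)] (- 3) 1"
  "plan [2, 0, 0, 2, 1, 2] [(- 1, 1, - 1), (0, 2, 1), (- 1, 3, 1)] 0 6"
  "plan [2, 1, 2, 3, 1, 4] [(- 1, 1, - 1), (0, 2, 1), (0, 3, 1)] (- 1) 3"
  "plan [0, 0, 1, 0, 0, 1] [(- 1, 1, - 1), (- 1, 5, 1)] (- 2) 2"
  "plan [3, 3, 3, 1, 1, 2] [(- 1, 1, 0), (- 1, 1, 1), (0, 1, 1), (1, 1, 1), (- 1, 2, 1)] (- 1) 3"
  "plan [0, 0, 0, 0, 2, 0] [(- 1, 1, 0), (- 1, 1, 1), (1, 1, 1), (- 1, 3, - 1)] (- 3) 5"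
  "plan [2, 1, 0, 0, 0, 0] [(- 1, 1, 0), (- 1, 1, 1), (1, 1, 1), (0, 3, 1)] (- 2) 4"
  "plan [1, 1, 0, 1, 0, 2] [(- 1, 1, 0), (- 1, 1, 1), (- 1, 2, 0), (- 1, 2, 1)] (- 2) 2"
  "plan [0, 0, 0, 0, 0, 0] [(- 1, 1, 0), (- 1, 1, 1), (- 1, 4, - 1)] (- 2) 4"
  "plan [0, 2, 0, 2, 0, 1] [(- 1, 1, 0), (- 1, 1, 1), (- 1, 4, 0)] (- 3) 1"
  "plan [0, 1, 0, 0, 0, 0] [(- 1, 1, 0), (- 1, 1, 1), (- 1, 4, 1)] 0 4"
  "plan [0, 1, 0, 0, 0, 0] [(- 1, 1, 0), (- 1, 1, 1), (0, 4, 1)] (- 1) 3"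
  "plan [0, 2, 0, 4, 4, 0] [(- 1, 1, 0), (0, 1, 1), (- 1, 4, - 1)] (- 3) 3"
  "plan [0, 1, 0, 0, 0, 0] [(- 1, 1, 0), (0, 1, 1), (- 1, 4, 1)] (- 1) 3"
  "plan [2, 1, 2, 0, 2, 0] [(- 1, 1, 0), (0, 1, 1), (1, 4, 1)] (- 1) 1"
  "plan [1, 2, 3, 3, 3, 3] [(- 1, 1, 0), (1, 1, 1), (- 1, 2, 1), (- 1, 2, 1)] (- 1) 3"
  "plan [4, 2, 0, 1, 0, 3] [(- 1, 1, 0), (1, 1, 1), (- 1, 4, 0)] (- 1) 3"
  "plan [2, 0, 0, 1, 1, 1] [(- 1, 1, 0), (1, 1, 1), (1, 4, 1)] 0 6"
  "plan [0, 1, 3, 0, 4, 0] [(- 1, 1, 0), (- 1, 2, 1), (- 1, 3, - 1)] (- 2) 2"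
  "plan [1, 0, 4, 1, 1, 4] [(- 1, 1, 0), (- 1, 2, 1), (- 1, 3, 1)] (- 4) 2"
  "plan [2, 0, 2, 2, 0, 0] [(- 1, 1, 0), (- 1, 2, 1), (0, 3, 1)] (- 1) 3"
  "plan [0, 0, 2, 0, 0, 0] [(- 1, 1, 0), (0, 2, 1), (- 1, 3, 1)] (- 1) 3"
  "plan [1, 0, 2, 1, 0, 0] [(- 1, 1, 0), (0, 2, 1), (1, 3, 1)] (- 3) 1"
  "plan [0, 0, 0, 0, 0, 0] [(- 1, 1, 0), (- 1, 5, 0)] 0 4"
  "plan [0, 0, 1, 0, 0, 1] [(- 1, 1, 0), (- 1, 5, 1)] (- 1) 3"
  "plan [3, 0, 0, 0, 2, 0] [(- 1, 1, 1), (0, 1, 1), (1, 1, 1), (- 1, 3, - 1)] (- 1) 3"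
  "plan [1, 1, 1, 0, 2, 0] [(- 1, 1, 1), (0, 1, 1), (1, 1, 1), (- 1, 3, 0)] (- 2) 2"
  "plan [0, 3, 1, 0, 0, 0] [(- 1, 1, 1), (0, 1, 1), (1, 1, 1), (- 1, 3, 1)] (- 1) 3"
  "plan [2, 2, 0, 0, 0, 0] [(- 1, 1, 1), (0, 1, 1), (1, 1, 1), (0, 3, 1)] 0 4"
  "plan [1, 0, 3, 0, 3, 0] [(- 1, 1, 1), (0, 1, 1), (- 1, 2, 1), (- 1, 2, 1)] (- 1) 5"
  "plan [0, 0, 0, 0, 2, 0] [(- 1, 1, 1), (0, 1, 1), (- 1, 4, - 1)] (- 2) 4"
  "plan [0, 0, 1, 0, 0, 0] [(- 1, 1, 1), (0, 1, 1), (- 1, 4, 0)] (- 1) 3"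
  "plan [1, 1, 0, 3, 0, 1] [(- 1, 1, 1), (0, 1, 1), (- 1, 4, 1)] (- 4) 2"
  "plan [1, 1, 0, 3, 0, 1] [(- 1, 1, 1), (0, 1, 1), (- 1, 4, 1)] (- 2) 2"
  "plan [0, 1, 0, 0, 0, 0] [(- 1, 1, 1), (0, 1, 1), (- 1, 4, 1)] 0 4"
  "plan [2, 1, 1, 1, 1, 1] [(- 1, 1, 1), (0, 1, 1), (1, 4, 1)] 0 2"
  "plan [0, 4, 1, 3, 2, 2] [(- 1, 1, 1), (1, 1, 1), (- 1, 2, 0), (0, 2, 1)] (- 2) 2"
  "plan [1, 0, 3, 1, 3, 1] [(- 1, 1, 1), (1, 1, 1), (- 1, 2, 1), (- 1, 2, 1)] 0 4"
  "plan [1, 2, 3, 3, 3, 3] [(- 1, 1, 1), (1, 1, 1), (- 1, 2, 1), (0, 2, 1)] (- 1) 3"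
  "plan [1, 0, 3, 1, 3, 1] [(- 1, 1, 1), (1, 1, 1), (0, 2, 1), (0, 2, 1)] 0 4"
  "plan [0, 1, 0, 1, 0, 1] [(- 1, 1, 1), (1, 1, 1), (- 1, 4, 1)] (- 1) 3"
  "plan [2, 1, 1, 1, 1, 1] [(- 1, 1, 1), (1, 1, 1), (0, 4, 1)] 0 2"
  "plan [2, 1, 1, 1, 1, 1] [(- 1, 1, 1), (1, 1, 1), (1, 4, 1)] 1 3"
  "plan [0, 0, 0, 1, 0, 0] [(- 1, 1, 1), (- 1, 2, 0), (0, 3, 1)] (- 1) 3"
  "plan [0, 0, 1, 0, 0, 0] [(- 1, 1, 1), (- 1, 2, 1), (- 1, 3, - 1)] (- 1) 3"
  "plan [1, 0, 4, 1, 1, 4] [(- 1, 1, 1), (- 1, 2, 1), (- 1, 3, 1)] (- 3) 1"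
  "plan [1, 0, 0, 1, 0, 0] [(- 1, 1, 1), (- 1, 2, 1), (1, 3, 1)] (- 1) 9"
  "plan [3, 0, 0, 0, 2, 0] [(- 1, 1, 1), (0, 2, 1), (- 1, 3, - 1)] 0 4"
  "plan [1, 0, 0, 1, 0, 0] [(- 1, 1, 1), (0, 2, 1), (- 1, 3, 0)] (- 1) 3"
  "plan [1, 0, 1, 0, 0, 0] [(- 1, 1, 1), (- 1, 5, - 1)] (- 2) 2"
  "plan [1, 0, 0, 0, 0, 0] [(- 1, 1, 1), (- 1, 5, 0)] (- 1) 3"
  "plan [0, 0, 0, 0, 0, 0] [(- 1, 1, 1), (- 1, 5, 1)] 0 4"
  "plan [0, 0, 0, 0, 0, 0] [(- 1, 1, 1), (0, 5, 1)] (- 1) 3"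
  "plan [0, 0, 0, 0, 0, 0] [(- 1, 1, 1), (1, 5, 1)] (- 2) 2"
  "plan [0, 0, 0, 0, 2, 0] [(0, 1, 1), (1, 1, 1), (- 1, 4, - 1)] (- 2) 4"
  "plan [0, 1, 0, 3, 0, 1] [(0, 1, 1), (1, 1, 1), (- 1, 4, 1)] (- 2) 4"
  "plan [0, 0, 0, 0, 0, 0] [(0, 1, 1), (1, 1, 1), (- 1, 4, 1)] 0 6"
  "plan [2, 1, 1, 1, 1, 1] [(0, 1, 1), (1, 1, 1), (1, 4, 1)] 0 2"
  "plan [1, 0, 1, 3, 0, 0] [(0, 1, 1), (- 1, 2, 0), (- 1, 3, 1)] (- 1) 3"
  "plan [1, 0, 1, 1, 0, 0] [(0, 1, 1), (- 1, 2, 0), (1, 3, 1)] (- 3) 1"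
  "plan [1, 0, 1, 0, 2, 0] [(0, 1, 1), (- 1, 2, 1), (- 1, 3, - 1)] (- 2) 2"
  "plan [1, 0, 3, 0, 0, 0] [(0, 1, 1), (- 1, 2, 1), (- 1, 3, 0)] (- 1) 3"
  "plan [1, 0, 4, 1, 1, 4] [(0, 1, 1), (- 1, 2, 1), (- 1, 3, 1)] (- 4) 2"
  "plan [1, 0, 2, 0, 0, 1] [(0, 1, 1), (- 1, 5, 0)] (- 2) 2"
  "plan [1, 0, 4, 0, 0, 1] [(0, 1, 1), (- 1, 5, 1)] (- 1) 3"
  "plan [1, 2, 1, 0, 1, 2] [(1, 1, 1), (0, 2, 1), (0, 3, 1)] (- 1) 3"
  "plan [1, 0, 0, 0, 0, 0] [(1, 1, 1), (- 1, 5, - 1)] 0 4"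
  "plan [0, 2, 1, 2, 1, 2] [(- 1, 2, 0), (- 1, 2, 1), (- 1, 2, 1)] (- 4) 2"
  "plan [0, 3, 0, 4, 1, 1] [(- 1, 2, 0), (- 1, 2, 1), (0, 2, 1)] (- 1) 5"
  "plan [0, 1, 0, 3, 0, 1] [(- 1, 2, 0), (- 1, 4, 1)] (- 1) 5"
  "plan [1, 1, 4, 2, 0, 1] [(- 1, 2, 0), (0, 4, 1)] (- 2) 2"
  "plan [0, 2, 0, 2, 0, 2] [(- 1, 2, 1), (- 1, 2, 1), (- 1, 2, 1)] (- 3) 1"
  "plan [0, 2, 0, 1, 0, 0] [(- 1, 2, 1), (- 1, 4, - 1)] (- 2) 2"
  "plan [0, 0, 0, 1, 0, 0] [(- 1, 2, 1), (- 1, 4, 0)] (- 1) 5"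
  "plan [0, 1, 0, 0, 0, 0] [(- 1, 2, 1), (- 1, 4, 1)] 0 4"
  "plan [0, 1, 0, 0, 0, 0] [(- 1, 2, 1), (0, 4, 1)] (- 1) 5"
  "plan [0, 1, 2, 0, 0, 0] [(- 1, 2, 1), (1, 4, 1)] (- 2) 2"
  "plan [0, 0, 0, 0, 2, 0] [(0, 2, 1), (- 1, 4, - 1)] (- 1) 5"
  "plan [1, 1, 0, 3, 0, 1] [(0, 2, 1), (- 1, 4, 1)] (- 1) 3"
  "plan [0, 0, 0, 0, 0, 0] [(0, 2, 1), (- 1, 4, 1)] 1 7"
  "plan [0, 1, 0, 1, 0, 2] [(0, 2, 1), (0, 4, 1)] 0 4"
  "plan [0, 2, 0, 0, 1, 3] [(- 1, 3, - 1), (- 1, 3, 1)] (- 2) 2"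
  "plan [0, 0, 0, 0, 0, 0] [(- 1, 3, 0), (- 1, 3, 0)] 0 6"
  "plan [0, 0, 0, 0, 0, 0] [(- 1, 3, 1), (- 1, 3, 1)] 0 4"
  "plan [1, 2, 3, 1, 1, 1] [(- 1, 6, - 1)] (- 3) 1"
  "plan [0, 0, 0, 0, 0, 0] [(- 1, 6, - 1)] 1 5"
  "plan [1, 3, 0, 1, 1, 1] [(- 1, 6, 0)] (- 2) 2"
  "plan [0, 0, 0, 1, 0, 0] [(- 1, 6, 0)] 0 6"
  "plan [0, 1, 0, 0, 0, 1] [(- 1, 6, 1)] (- 1) 3"
  "plan [1, 3, 0, 4, 1, 3] [(0, 6, 0)] (- 1) 1"
  "plan [0, 0, 1, 2, 2, 0] [(0, 6, 1)] 0 6"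
  "plan [1, 1, 0, 0, 0, 3] [(1, 6, 1)] (- 3) 1"
  "plan [0, 0, 1, 2, 2, 0] [(1, 6, 1)] 1 5"
  by (rule planI; simp add: respond_def cuts_def upto_rec1 safe_Nil safe_2 safe_4)+

lemmas safe_6 = plan_6[THEN plan_weaken]

lemma plan_8:
  "plan [3, 4, 1, 1, 1, 3, 1, 3] [(- 1, 1, - 1), (- 1, 1, 0), (- 1, 1, 1), (0, 1, 1), (- 1, 2, 1), (- 1, 2, 1)] (- 4) 2"
  "plan [0, 0, 0, 1, 1, 1, 1, 1] [(- 1, 1, - 1), (- 1, 1, 0), (- 1, 1, 1), (0, 1, 1), (1, 4, 1)] (- 1) 3"
  "plan [3, 3, 4, 1, 2, 1, 0, 0] [(- 1, 1, - 1), (- 1, 1, 0), (- 1, 1, 1), (- 1, 2, 0), (1, 3, 1)] (- 3) 1"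
  "plan [1, 4, 3, 0, 6, 3, 1, 6] [(- 1, 1, - 1), (- 1, 1, 0), (- 1, 1, 1), (- 1, 2, 1), (0, 3, 1)] (- 3) 1"
  "plan [2, 2, 3, 1, 3, 2, 1, 5] [(- 1, 1, - 1), (- 1, 1, 0), (1, 1, 1), (- 1, 2, 1), (0, 3, 1)] (- 1) 5"
  "plan [4, 2, 6, 5, 3, 0, 1, 4] [(- 1, 1, - 1), (- 1, 1, 0), (1, 1, 1), (0, 2, 1), (- 1, 3, 1)] (- 1) 3"
  "plan [0, 0, 1, 0, 0, 0, 0, 0] [(- 1, 1, - 1), (- 1, 1, 0), (0, 2, 1), (- 1, 4, 1)] 0 6"
  "plan [1, 1, 3, 1, 4, 1, 0, 0] [(- 1, 1, - 1), (- 1, 1, 0), (0, 3, 1), (1, 3, 1)] (- 2) 2"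
  "plan [0, 0, 0, 2, 3, 1, 1, 0] [(- 1, 1, - 1), (- 1, 1, 0), (- 1, 6, - 1)] (- 4) 2"
  "plan [0, 2, 2, 1, 4, 0, 1, 2] [(- 1, 1, - 1), (- 1, 1, 0), (- 1, 6, 1)] (- 4) 2"
  "plan [0, 4, 5, 0, 0, 2, 0, 0] [(- 1, 1, - 1), (- 1, 1, 0), (0, 6, 1)] (- 1) 5"
  "plan [3, 0, 4, 0, 0, 4, 0, 0] [(- 1, 1, - 1), (- 1, 1, 0), (1, 6, 1)] (- 2) 2"
  "plan [0, 3, 6, 0, 3, 0, 3, 4] [(- 1, 1, - 1), (- 1, 1, 1), (0, 1, 1), (- 1, 2, 1), (- 1, 3, 0)] (- 3) 1"
  "plan [3, 4, 2, 4, 0, 6, 4, 6] [(- 1, 1, - 1), (- 1, 1, 1), (- 1, 2, 0), (- 1, 2, 1), (0, 2, 1)] (- 3) 1"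
  "plan [0, 2, 0, 3, 0, 0, 0, 0] [(- 1, 1, - 1), (- 1, 1, 1), (- 1, 2, 1), (- 1, 4, 1)] (- 2) 2"
  "plan [0, 2, 0, 3, 2, 0, 0, 0] [(- 1, 1, - 1), (- 1, 1, 1), (- 1, 2, 1), (1, 4, 1)] (- 4) 0"
  "plan [1, 0, 1, 0, 0, 1, 1, 1] [(- 1, 1, - 1), (- 1, 1, 1), (- 1, 2, 1), (1, 4, 1)] 0 4"
  "plan [0, 3, 1, 1, 6, 1, 1, 6] [(- 1, 1, - 1), (- 1, 1, 1), (- 1, 3, 1), (- 1, 3, 1)] (- 2) 2"
  "plan [0, 0, 0, 0, 0, 0, 0, 0] [(- 1, 1, - 1), (- 1, 1, 1), (- 1, 6, - 1)] (- 1) 3"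
  "plan [0, 6, 4, 1, 4, 4, 1, 2] [(- 1, 1, - 1), (- 1, 1, 1), (- 1, 6, 0)] (- 4) 2"
  "plan [0, 2, 0, 1, 4, 0, 1, 2] [(- 1, 1, - 1), (- 1, 1, 1), (- 1, 6, 1)] (- 3) 1"
  "plan [0, 0, 0, 0, 0, 1, 0, 0] [(- 1, 1, - 1), (- 1, 1, 1), (1, 6, 1)] (- 1) 3"
  "plan [2, 5, 3, 1, 2, 0, 1, 0] [(- 1, 1, - 1), (0, 1, 1), (1, 1, 1), (- 1, 2, 1), (- 1, 3, 0)] (- 1) 5"
  "plan [2, 2, 1, 4, 1, 0, 0, 1] [(- 1, 1, - 1), (0, 1, 1), (1, 1, 1), (- 1, 5, 1)] (- 1) 5"
  "plan [1, 2, 0, 2, 0, 6, 0, 6] [(- 1, 1, - 1), (0, 1, 1), (- 1, 2, 0), (- 1, 2, 1), (- 1, 2, 1)] (- 5) 1"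
  "plan [1, 2, 1, 2, 0, 1, 0, 1] [(- 1, 1, - 1), (0, 1, 1), (- 1, 2, 1), (- 1, 4, 1)] (- 1) 5"
  "plan [0, 2, 2, 3, 2, 0, 0, 0] [(- 1, 1, - 1), (0, 1, 1), (- 1, 2, 1), (1, 4, 1)] (- 5) 1"
  "plan [1, 2, 1, 2, 0, 0, 0, 0] [(- 1, 1, - 1), (1, 1, 1), (- 1, 2, 1), (- 1, 4, 1)] 0 4"
  "plan [0, 0, 3, 4, 3, 5, 1, 4] [(- 1, 1, - 1), (- 1, 2, 1), (0, 2, 1), (0, 3, 1)] (- 2) 2"
  "plan [1, 0, 3, 0, 3, 0, 0, 1] [(- 1, 1, - 1), (- 1, 2, 1), (- 1, 5, 1)] (- 3) 1"
  "plan [2, 1, 1, 0, 1, 0, 0, 0] [(- 1, 1, - 1), (0, 2, 1), (- 1, 5, 0)] (- 1) 7"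
  "plan [0, 2, 1, 3, 6, 4, 1, 1] [(- 1, 1, - 1), (- 1, 3, 0), (0, 4, 1)] (- 1) 5"
  "plan [0, 6, 2, 4, 0, 1, 0, 1] [(- 1, 1, - 1), (0, 3, 1), (- 1, 4, 0)] (- 1) 5"
  "plan [0, 3, 0, 0, 0, 0, 0, 0] [(- 1, 1, - 1), (- 1, 7, 1)] 0 4"
  "plan [0, 1, 0, 0, 0, 0, 0, 0] [(- 1, 1, - 1), (0, 7, 1)] (- 3) 3"
  "plan [0, 1, 0, 0, 0, 0, 0, 0] [(- 1, 1, - 1), (1, 7, 1)] (- 2) 2"
  "plan [2, 4, 0, 1, 3, 0, 0, 0] [(- 1, 1, 0), (- 1, 1, 1), (0, 1, 1), (- 1, 2, 1), (- 1, 3, 1)] (- 1) 3"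
  "plan [0, 1, 3, 1, 2, 0, 0, 1] [(- 1, 1, 0), (- 1, 1, 1), (0, 1, 1), (- 1, 5, 1)] (- 2) 2"
  "plan [0, 0, 0, 1, 2, 0, 0, 1] [(- 1, 1, 0), (- 1, 1, 1), (0, 1, 1), (- 1, 5, 1)] (- 2) 6"
  "plan [2, 5, 6, 2, 5, 0, 5, 4] [(- 1, 1, 0), (- 1, 1, 1), (1, 1, 1), (- 1, 2, 0), (- 1, 3, 1)] (- 1) 3"
  "plan [2, 4, 4, 4, 1, 1, 2, 1] [(- 1, 1, 0), (- 1, 1, 1), (1, 1, 1), (0, 5, 1)] 0 4"
  "plan [1, 1, 0, 1, 0, 0, 0, 0] [(- 1, 1, 0), (- 1, 1, 1), (- 1, 2, 0), (- 1, 4, 1)] 0 4"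
  "plan [1, 5, 3, 2, 3, 2, 1, 2] [(- 1, 1, 0), (- 1, 1, 1), (- 1, 2, 1), (- 1, 2, 1), (0, 2, 1)] (- 1) 3"
  "plan [0, 2, 0, 6, 0, 2, 0, 1] [(- 1, 1, 0), (- 1, 1, 1), (- 1, 2, 1), (0, 4, 1)] (- 2) 4"
  "plan [1, 4, 1, 2, 0, 1, 1, 1] [(- 1, 1, 0), (- 1, 1, 1), (0, 2, 1), (1, 4, 1)] 0 4"
  "plan [0, 0, 1, 2, 0, 1, 1, 1] [(- 1, 1, 0), (- 1, 1, 1), (- 1, 6, - 1)] (- 4) 2"
  "plan [1, 0, 0, 0, 0, 0, 0, 1] [(- 1, 1, 0), (- 1, 1, 1), (- 1, 6, 0)] (- 1) 3"
  "plan [2, 0, 1, 1, 0, 4, 0, 3] [(- 1, 1, 0), (- 1, 1, 1), (1, 6, 1)] (- 2) 2"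
  "plan [2, 0, 3, 1, 3, 1, 3, 1] [(- 1, 1, 0), (0, 1, 1), (- 1, 2, 1), (- 1, 2, 1), (- 1, 2, 1)] (- 3) 3"
  "plan [1, 0, 1, 0, 0, 1, 1, 1] [(- 1, 1, 0), (0, 1, 1), (- 1, 2, 1), (1, 4, 1)] 0 6"
  "plan [0, 0, 0, 0, 2, 0, 4, 0] [(- 1, 1, 0), (0, 1, 1), (- 1, 6, - 1)] (- 1) 7"
  "plan [1, 1, 4, 1, 1, 1, 1, 1] [(- 1, 1, 0), (1, 1, 1), (- 1, 2, 0), (1, 4, 1)] 0 4"
  "plan [1, 2, 1, 4, 5, 0, 1, 0] [(- 1, 1, 0), (1, 1, 1), (- 1, 2, 1), (0, 4, 1)] 0 4"
  "plan [1, 2, 1, 2, 0, 1, 0, 1] [(- 1, 1, 0), (1, 1, 1), (0, 2, 1), (- 1, 4, 1)] 0 4"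
  "plan [4, 2, 0, 0, 0, 0, 1, 5] [(- 1, 1, 0), (1, 1, 1), (- 1, 3, 1), (0, 3, 1)] 0 6"
  "plan [2, 2, 0, 2, 3, 0, 1, 3] [(- 1, 1, 0), (1, 1, 1), (0, 6, 1)] (- 1) 7"
  "plan [0, 0, 1, 1, 1, 0, 0, 1] [(- 1, 1, 0), (- 1, 2, 0), (- 1, 5, 1)] (- 1) 3"
  "plan [4, 0, 3, 0, 3, 2, 1, 4] [(- 1, 1, 0), (- 1, 2, 1), (- 1, 2, 1), (0, 3, 1)] (- 2) 2"
  "plan [5, 0, 6, 1, 3, 5, 1, 4] [(- 1, 1, 0), (- 1, 2, 1), (0, 2, 1), (- 1, 3, 1)] (- 2) 2"
  "plan [1, 1, 4, 0, 1, 6, 0, 0] [(- 1, 1, 0), (- 1, 2, 1), (- 1, 5, - 1)] (- 4) 2"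
  "plan [6, 0, 3, 0, 1, 0, 0, 4] [(- 1, 1, 0), (- 1, 2, 1), (- 1, 5, 0)] (- 1) 3"
  "plan [4, 4, 4, 1, 1, 1, 2, 1] [(- 1, 1, 0), (- 1, 2, 1), (1, 5, 1)] 0 4"
  "plan [4, 1, 2, 0, 0, 5, 1, 0] [(- 1, 1, 0), (0, 2, 1), (1, 5, 1)] (- 1) 3"
  "plan [1, 0, 3, 0, 0, 0, 4, 0] [(- 1, 1, 0), (- 1, 3, - 1), (0, 4, 1)] (- 1) 3"
  "plan [0, 0, 1, 3, 0, 4, 0, 1] [(- 1, 1, 0), (- 1, 3, 0), (- 1, 4, 1)] (- 1) 3"
  "plan [0, 0, 0, 0, 0, 2, 0, 1] [(- 1, 1, 0), (- 1, 3, 1), (- 1, 4, 0)] (- 1) 3"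
  "plan [0, 2, 0, 0, 0, 3, 0, 1] [(- 1, 1, 0), (- 1, 3, 1), (- 1, 4, 1)] 0 6"
  "plan [0, 2, 0, 0, 0, 1, 0, 0] [(- 1, 1, 0), (0, 3, 1), (- 1, 4, - 1)] (- 1) 5"
  "plan [0, 2, 0, 0, 0, 0, 0, 0] [(- 1, 1, 0), (0, 3, 1), (- 1, 4, 1)] 1 7"
  "plan [0, 1, 0, 0, 0, 4, 0, 1] [(- 1, 1, 0), (1, 3, 1), (- 1, 4, 0)] (- 3) 1"
  "plan [1, 1, 2, 0, 1, 1, 1, 6] [(- 1, 1, 0), (- 1, 7, 0)] (- 2) 2"
  "plan [3, 2, 0, 0, 0, 2, 0, 0] [(- 1, 1, 1), (0, 1, 1), (1, 1, 1), (- 1, 5, 0)] 0 4"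
  "plan [1, 0, 3, 1, 0, 0, 0, 0] [(- 1, 1, 1), (0, 1, 1), (- 1, 2, 1), (- 1, 4, - 1)] (- 1) 5"
  "plan [2, 2, 0, 5, 1, 1, 0, 1] [(- 1, 1, 1), (0, 1, 1), (- 1, 2, 1), (- 1, 4, 0)] (- 2) 2"
  "plan [0, 0, 0, 0, 0, 1, 0, 1] [(- 1, 1, 1), (0, 1, 1), (- 1, 2, 1), (- 1, 4, 1)] (- 1) 5"
  "plan [4, 1, 4, 4, 0, 1, 1, 1] [(- 1, 1, 1), (0, 1, 1), (- 1, 2, 1), (0, 4, 1)] 0 4"
  "plan [2, 0, 0, 2, 0, 0, 0, 0] [(- 1, 1, 1), (0, 1, 1), (- 1, 3, - 1), (- 1, 3, 1)] (- 1) 3"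
  "plan [2, 2, 0, 2, 0, 1, 0, 0] [(- 1, 1, 1), (0, 1, 1), (- 1, 3, - 1), (0, 3, 1)] (- 2) 2"
  "plan [1, 1, 0, 0, 0, 0, 0, 0] [(- 1, 1, 1), (0, 1, 1), (- 1, 3, 1), (0, 3, 1)] 0 6"
  "plan [2, 0, 0, 2, 0, 1, 1, 0] [(- 1, 1, 1), (0, 1, 1), (- 1, 6, - 1)] (- 2) 2"
  "plan [0, 0, 1, 3, 0, 1, 1, 0] [(- 1, 1, 1), (0, 1, 1), (- 1, 6, 0)] (- 3) 3"
  "plan [2, 0, 0, 0, 0, 3, 0, 0] [(- 1, 1, 1), (0, 1, 1), (- 1, 6, 1)] 0 4"
  "plan [0, 0, 0, 0, 0, 0, 0, 0] [(- 1, 1, 1), (0, 1, 1), (0, 6, 1)] (- 1) 9"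
  "plan [2, 0, 1, 0, 0, 4, 0, 0] [(- 1, 1, 1), (0, 1, 1), (1, 6, 1)] (- 2) 2"
  "plan [1, 2, 6, 1, 0, 0, 0, 0] [(- 1, 1, 1), (1, 1, 1), (0, 2, 1), (- 1, 4, 0)] 0 4"
  "plan [2, 2, 0, 2, 0, 0, 0, 0] [(- 1, 1, 1), (1, 1, 1), (- 1, 3, - 1), (- 1, 3, 0)] (- 1) 7"
  "plan [1, 2, 0, 0, 4, 0, 0, 0] [(- 1, 1, 1), (1, 1, 1), (- 1, 3, 0), (0, 3, 1)] 0 6"
  "plan [2, 0, 0, 0, 0, 0, 0, 0] [(- 1, 1, 1), (1, 1, 1), (- 1, 6, 1)] 1 5"
  "plan [1, 0, 0, 2, 4, 0, 0, 0] [(- 1, 1, 1), (- 1, 2, 0), (0, 2, 1), (- 1, 3, - 1)] 0 6"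
  "plan [4, 2, 0, 2, 0, 0, 0, 0] [(- 1, 1, 1), (- 1, 2, 1), (- 1, 2, 1), (- 1, 3, 1)] 0 4"
  "plan [1, 0, 1, 1, 0, 0, 0, 0] [(- 1, 1, 1), (- 1, 2, 1), (- 1, 5, 1)] (- 1) 3"
  "plan [4, 4, 0, 1, 1, 1, 2, 1] [(- 1, 1, 1), (- 1, 2, 1), (0, 5, 1)] 0 6"
  "plan [4, 4, 0, 1, 1, 1, 2, 1] [(- 1, 1, 1), (- 1, 2, 1), (1, 5, 1)] 1 5"
  "plan [4, 0, 0, 1, 4, 0, 0, 1] [(- 1, 1, 1), (0, 2, 1), (- 1, 5, 1)] 0 6"
  "plan [4, 3, 3, 3, 1, 2, 0, 1] [(- 1, 1, 1), (- 1, 3, - 1), (0, 4, 1)] (- 4) 2"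
  "plan [0, 0, 0, 0, 0, 1, 1, 1] [(- 1, 1, 1), (- 1, 3, 1), (1, 4, 1)] 1 7"
  "plan [0, 0, 0, 0, 0, 0, 0, 0] [(- 1, 1, 1), (1, 3, 1), (0, 4, 1)] 0 10"
  "plan [0, 0, 0, 0, 0, 0, 0, 0] [(- 1, 1, 1), (- 1, 7, - 1)] 0 6"
  "plan [0, 0, 0, 0, 1, 4, 0, 0] [(- 1, 1, 1), (- 1, 7, 0)] (- 1) 7"
  "plan [0, 0, 1, 2, 0, 0, 1, 2] [(- 1, 1, 1), (- 1, 7, 1)] (- 2) 2"
  "plan [0, 0, 0, 0, 1, 1, 0, 0] [(- 1, 1, 1), (1, 7, 1)] 0 4"
  "plan [1, 0, 0, 0, 5, 1, 5, 5] [(0, 1, 1), (1, 1, 1), (- 1, 2, 0), (- 1, 4, 1)] 0 8"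
  "plan [1, 0, 3, 4, 5, 1, 0, 5] [(0, 1, 1), (1, 1, 1), (- 1, 2, 1), (- 1, 4, - 1)] (- 1) 5"
  "plan [1, 2, 3, 5, 5, 1, 0, 5] [(0, 1, 1), (1, 1, 1), (- 1, 2, 1), (- 1, 4, 0)] 0 4"
  "plan [4, 2, 0, 4, 0, 0, 0, 0] [(0, 1, 1), (1, 1, 1), (- 1, 3, - 1), (0, 3, 1)] 0 4"
  "plan [2, 2, 0, 4, 0, 0, 0, 0] [(0, 1, 1), (1, 1, 1), (- 1, 3, 0), (- 1, 3, 1)] 0 6"
  "plan [0, 0, 0, 0, 0, 0, 4, 0] [(0, 1, 1), (1, 1, 1), (- 1, 6, - 1)] 0 6"
  "plan [0, 0, 1, 3, 0, 3, 1, 0] [(0, 1, 1), (1, 1, 1), (- 1, 6, 0)] (- 1) 5"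
  "plan [2, 0, 0, 0, 0, 3, 0, 0] [(0, 1, 1), (1, 1, 1), (- 1, 6, 1)] 0 6"
  "plan [2, 0, 0, 0, 1, 3, 3, 0] [(0, 1, 1), (1, 1, 1), (0, 6, 1)] 1 7"
  "plan [1, 4, 1, 0, 6, 3, 1, 6] [(0, 1, 1), (- 1, 2, 0), (- 1, 2, 1), (- 1, 3, 1)] (- 2) 2"
  "plan [1, 2, 0, 2, 0, 0, 3, 0] [(0, 1, 1), (- 1, 2, 1), (- 1, 2, 1), (- 1, 3, - 1)] (- 1) 5"
  "plan [0, 0, 0, 0, 0, 0, 0, 0] [(0, 1, 1), (- 1, 3, - 1), (- 1, 4, 1)] 0 6"
  "plan [0, 0, 4, 0, 0, 1, 1, 1] [(0, 1, 1), (- 1, 3, - 1), (1, 4, 1)] 0 4"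
  "plan [0, 0, 0, 0, 0, 0, 0, 0] [(0, 1, 1), (- 1, 3, 0), (- 1, 4, - 1)] (- 1) 7"
  "plan [1, 1, 2, 0, 0, 2, 0, 1] [(0, 1, 1), (- 1, 3, 0), (- 1, 4, 1)] (- 3) 3"
  "plan [0, 0, 0, 0, 0, 0, 0, 0] [(0, 1, 1), (- 1, 3, 0), (- 1, 4, 1)] 1 5"
  "plan [0, 0, 0, 0, 0, 0, 0, 0] [(0, 1, 1), (- 1, 3, 0), (- 1, 4, 1)] 1 9"
  "plan [5, 1, 5, 2, 1, 6, 3, 0] [(0, 1, 1), (- 1, 3, 1), (- 1, 4, 0)] (- 3) 3"
  "plan [1, 0, 0, 0, 0, 4, 0, 1] [(0, 1, 1), (- 1, 3, 1), (- 1, 4, 1)] 0 6"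
  "plan [1, 0, 0, 0, 0, 4, 0, 1] [(0, 1, 1), (0, 3, 1), (- 1, 4, 1)] (- 1) 5"
  "plan [0, 0, 0, 0, 0, 1, 1, 1] [(0, 1, 1), (0, 3, 1), (1, 4, 1)] 1 5"
  "plan [1, 4, 0, 0, 0, 0, 0, 0] [(0, 1, 1), (- 1, 7, 0)] 0 4"
  "plan [0, 1, 3, 0, 0, 0, 0, 1] [(0, 1, 1), (- 1, 7, 1)] (- 3) 3"
  "plan [0, 1, 0, 0, 1, 1, 0, 0] [(0, 1, 1), (- 1, 7, 1)] (- 1) 5"
  "plan [0, 1, 1, 1, 2, 4, 4, 1] [(0, 1, 1), (1, 7, 1)] 1 7"
  "plan [3, 4, 2, 6, 2, 2, 2, 2] [(1, 1, 1), (- 1, 2, 0), (0, 5, 1)] (- 1) 3"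
  "plan [1, 2, 2, 2, 2, 0, 0, 0] [(1, 1, 1), (- 1, 2, 1), (- 1, 2, 1), (- 1, 3, - 1)] 0 6"
  "plan [1, 2, 5, 5, 5, 0, 0, 1] [(1, 1, 1), (0, 2, 1), (- 1, 5, 1)] 0 4"
  "plan [4, 2, 4, 5, 1, 2, 2, 2] [(1, 1, 1), (0, 2, 1), (0, 5, 1)] 1 5"
  "plan [0, 0, 0, 0, 0, 1, 1, 1] [(1, 1, 1), (- 1, 3, - 1), (1, 4, 1)] 1 5"
  "plan [4, 1, 4, 0, 1, 1, 0, 1] [(1, 1, 1), (- 1, 3, 0), (0, 4, 1)] (- 1) 5"
  "plan [1, 0, 0, 0, 0, 1, 0, 1] [(1, 1, 1), (- 1, 3, 1), (- 1, 4, 1)] 1 5"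
  "plan [0, 0, 0, 0, 0, 1, 0, 1] [(1, 1, 1), (- 1, 3, 1), (0, 4, 1)] 0 8"
  "plan [0, 0, 1, 4, 0, 5, 0, 4] [(1, 1, 1), (0, 3, 1), (- 1, 4, 0)] (- 1) 5"
  "plan [0, 0, 0, 0, 4, 1, 1, 1] [(1, 1, 1), (0, 3, 1), (0, 4, 1)] 1 7"
  "plan [0, 1, 1, 0, 1, 1, 0, 1] [(1, 1, 1), (- 1, 7, 1)] 0 4"
  "plan [0, 1, 1, 1, 3, 4, 4, 1] [(1, 1, 1), (0, 7, 1)] 1 7"
  "plan [0, 1, 1, 1, 2, 4, 4, 1] [(1, 1, 1), (1, 7, 1)] 2 6"
  "plan [1, 0, 1, 0, 1, 0, 1, 0] [(- 1, 2, 0), (- 1, 2, 1), (- 1, 2, 1), (- 1, 2, 1)] (- 1) 5"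
  "plan [1, 4, 0, 2, 0, 2, 4, 5] [(- 1, 2, 0), (- 1, 3, - 1), (0, 3, 1)] (- 1) 3"
  "plan [1, 3, 0, 3, 2, 2, 2, 2] [(- 1, 2, 0), (- 1, 3, 0), (- 1, 3, 1)] (- 1) 5"
  "plan [1, 3, 0, 4, 2, 6, 2, 6] [(- 1, 2, 0), (- 1, 3, 0), (1, 3, 1)] (- 3) 3"
  "plan [0, 0, 0, 5, 3, 1, 5, 0] [(- 1, 2, 0), (- 1, 6, - 1)] (- 1) 7"
  "plan [0, 0, 5, 0, 1, 2, 2, 0] [(- 1, 2, 0), (0, 6, 1)] 0 8"
  "plan [0, 2, 0, 2, 0, 1, 0, 0] [(- 1, 2, 1), (- 1, 2, 1), (- 1, 4, - 1)] (- 3) 1"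
  "plan [0, 2, 0, 2, 0, 0, 0, 0] [(- 1, 2, 1), (- 1, 2, 1), (- 1, 4, 1)] (- 1) 3"
  "plan [1, 0, 1, 0, 0, 1, 1, 1] [(- 1, 2, 1), (- 1, 2, 1), (1, 4, 1)] 1 5"
  "plan [0, 2, 0, 4, 3, 0, 4, 3] [(- 1, 2, 1), (- 1, 3, 0), (- 1, 3, 0)] (- 1) 5"
  "plan [0, 3, 4, 0, 0, 4, 0, 0] [(- 1, 2, 1), (- 1, 3, 1), (- 1, 3, 1)] (- 1) 3"
  "plan [0, 2, 0, 1, 0, 0, 0, 1] [(- 1, 2, 1), (- 1, 6, 1)] (- 2) 2"
  "plan [0, 0, 0, 0, 2, 1, 1, 0] [(- 1, 2, 1), (1, 6, 1)] 0 4"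
  "plan [0, 0, 0, 0, 0, 0, 0, 0] [(0, 2, 1), (- 1, 6, - 1)] 1 7"
  "plan [2, 0, 4, 0, 3, 1, 1, 0] [(0, 2, 1), (1, 6, 1)] (- 1) 3"
  "plan [0, 0, 0, 1, 0, 0, 0, 0] [(- 1, 3, - 1), (- 1, 5, 1)] 0 8"
  "plan [0, 3, 3, 1, 2, 3, 1, 6] [(- 1, 3, 0), (- 1, 5, 0)] (- 2) 2"
  "plan [4, 4, 0, 1, 1, 1, 1, 1] [(- 1, 3, 0), (0, 5, 1)] 0 4"
  "plan [4, 4, 0, 1, 1, 1, 1, 1] [(- 1, 3, 0), (0, 5, 1)] 0 8"
  "plan [0, 0, 0, 0, 0, 0, 0, 0] [(- 1, 3, 1), (- 1, 5, - 1)] 0 4"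
  "plan [0, 0, 0, 0, 0, 0, 0, 0] [(- 1, 3, 1), (- 1, 5, - 1)] 0 6"
  "plan [1, 1, 3, 1, 3, 0, 0, 1] [(- 1, 3, 1), (- 1, 5, 1)] (- 2) 2"
  "plan [2, 0, 0, 4, 1, 0, 0, 4] [(0, 3, 1), (- 1, 5, 0)] 0 6"
  "plan [0, 0, 2, 0, 0, 1, 0, 0] [(- 1, 4, - 1), (- 1, 4, 0)] (- 1) 7"
  "plan [0, 1, 0, 0, 0, 0, 0, 0] [(- 1, 4, - 1), (- 1, 4, 1)] 0 4"
  "plan [1, 4, 0, 1, 1, 4, 0, 1] [(- 1, 4, 0), (- 1, 4, 0)] (- 2) 4"
  "plan [0, 2, 3, 4, 0, 6, 0, 1] [(- 1, 4, 0), (- 1, 4, 1)] (- 1) 3"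
  "plan [0, 0, 0, 0, 0, 0, 0, 0] [(- 1, 4, 0), (- 1, 4, 1)] 1 7"
  "plan [0, 0, 0, 1, 0, 1, 0, 1] [(- 1, 4, 0), (0, 4, 1)] 0 4"
  "plan [1, 2, 3, 6, 1, 2, 3, 6] [(- 1, 4, 1), (- 1, 4, 1)] (- 2) 2"
  "plan [0, 0, 0, 0, 0, 0, 0, 0] [(- 1, 4, 1), (- 1, 4, 1)] 2 8"
  "plan [0, 0, 0, 0, 0, 0, 0, 0] [(- 1, 4, 1), (0, 4, 1)] 1 7"
  "plan [0, 0, 0, 0, 0, 1, 0, 0] [(- 1, 8, - 1)] (- 1) 3"
  "plan [0, 0, 0, 0, 0, 0, 0, 0] [(- 1, 8, 1)] 1 5"
  "plan [0, 0, 0, 0, 0, 0, 0, 0] [(1, 8, 1)] (- 1) 3"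
  by (rule planI; simp add: respond_def cuts_def upto_rec1 safe_Nil safe_2 safe_4 safe_6)+

lemmas safe_8 = plan_8[THEN plan_weaken]

lemma plan_10:
  "plan [4, 2, 1, 1, 0, 3, 2, 0, 2, 0] [(- 1, 1, - 1), (- 1, 1, 0), (- 1, 1, 1), (0, 1, 1), (- 1, 2, 1), (1, 4, 1)] (- 4) 2"
  "plan [4, 2, 5, 3, 1, 5, 2, 0, 0, 0] [(- 1, 1, - 1), (- 1, 1, 0), (- 1, 1, 1), (0, 3, 1), (1, 4, 1)] (- 3) 1"
  "plan [1, 0, 2, 0, 0, 1, 0, 0, 0, 0] [(- 1, 1, - 1), (- 1, 1, 1), (- 1, 3, 1), (- 1, 5, 1)] 0 4"
  "plan [1, 6, 8, 5, 6, 1, 2, 8, 0, 6] [(- 1, 1, - 1), (- 1, 1, 1), (0, 3, 1), (- 1, 5, 0)] (- 2) 2"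
  "plan [1, 2, 4, 2, 2, 1, 4, 0, 1, 2] [(- 1, 1, - 1), (0, 1, 1), (- 1, 2, 0), (- 1, 6, 1)] (- 4) 2"
  "plan [2, 1, 8, 2, 1, 1, 1, 1, 1, 1] [(- 1, 1, - 1), (0, 1, 1), (0, 8, 1)] (- 1) 3"
  "plan [0, 0, 2, 1, 0, 0, 1, 6, 0, 0] [(- 1, 1, - 1), (- 1, 2, 1), (- 1, 7, 1)] (- 1) 3"
  "plan [2, 2, 2, 3, 1, 6, 0, 0, 0, 0] [(- 1, 1, - 1), (0, 2, 1), (0, 3, 1), (- 1, 4, 1)] 0 6"
  "plan [0, 2, 0, 0, 2, 2, 0, 1, 0, 1] [(- 1, 1, - 1), (- 1, 3, 1), (- 1, 6, 1)] (- 1) 3"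
  "plan [1, 0, 0, 0, 0, 1, 2, 0, 0, 1] [(- 1, 1, - 1), (- 1, 4, 1), (- 1, 5, 1)] (- 1) 3"
  "plan [0, 0, 1, 0, 0, 1, 1, 0, 0, 1] [(- 1, 1, - 1), (- 1, 9, 1)] (- 2) 2"
  "plan [0, 0, 1, 1, 5, 2, 0, 4, 0, 1] [(- 1, 1, 0), (- 1, 1, 1), (- 1, 2, 1), (- 1, 6, 1)] (- 3) 3"
  "plan [3, 1, 1, 2, 5, 2, 1, 2, 3, 1] [(- 1, 1, 0), (- 1, 1, 1), (- 1, 2, 1), (0, 6, 1)] 0 8"
  "plan [3, 1, 6, 0, 2, 1, 1, 6, 2, 2] [(- 1, 1, 0), (- 1, 1, 1), (- 1, 3, 0), (1, 5, 1)] 0 8"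
  "plan [1, 1, 2, 0, 0, 1, 1, 0, 0, 1] [(- 1, 1, 0), (- 1, 1, 1), (0, 3, 1), (- 1, 5, 1)] 0 6"
  "plan [1, 3, 0, 1, 0, 1, 1, 1, 0, 1] [(- 1, 1, 0), (- 1, 1, 1), (0, 8, 1)] (- 1) 3"
  "plan [1, 3, 0, 1, 0, 1, 1, 1, 0, 1] [(- 1, 1, 0), (- 1, 1, 1), (0, 8, 1)] (- 1) 9"
  "plan [2, 2, 1, 2, 1, 2, 3, 1, 1, 1] [(- 1, 1, 0), (0, 1, 1), (- 1, 2, 1), (- 1, 6, - 1)] (- 4) 2"
  "plan [0, 2, 1, 2, 8, 2, 0, 4, 0, 8] [(- 1, 1, 0), (0, 1, 1), (- 1, 2, 1), (1, 6, 1)] (- 2) 2"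
  "plan [0, 0, 0, 3, 0, 1, 0, 3, 0, 1] [(- 1, 1, 0), (0, 1, 1), (- 1, 4, 1), (- 1, 4, 1)] 0 6"
  "plan [0, 2, 4, 2, 0, 1, 1, 1, 0, 1] [(- 1, 1, 0), (0, 1, 1), (- 1, 8, 1)] (- 1) 3"
  "plan [1, 3, 7, 2, 2, 2, 4, 4, 5, 2] [(- 1, 1, 0), (1, 1, 1), (0, 8, 1)] 1 5"
  "plan [1, 0, 0, 6, 6, 1, 1, 4, 2, 2] [(- 1, 1, 0), (- 1, 2, 0), (- 1, 2, 1), (1, 5, 1)] 0 6"
  "plan [1, 2, 1, 5, 0, 0, 1, 2, 0, 0] [(- 1, 1, 0), (- 1, 2, 0), (1, 7, 1)] (- 1) 3"
  "plan [4, 1, 6, 1, 6, 4, 1, 4, 2, 2] [(- 1, 1, 0), (- 1, 2, 1), (- 1, 2, 1), (0, 5, 1)] 0 6"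
  "plan [0, 4, 6, 1, 3, 5, 0, 0, 0, 0] [(- 1, 1, 0), (- 1, 2, 1), (0, 2, 1), (- 1, 5, 1)] 0 4"
  "plan [4, 2, 3, 0, 0, 2, 6, 6, 6, 6] [(- 1, 1, 0), (- 1, 2, 1), (- 1, 3, 0), (1, 4, 1)] 0 6"
  "plan [2, 0, 2, 2, 1, 4, 0, 0, 0, 0] [(- 1, 1, 0), (- 1, 2, 1), (0, 3, 1), (- 1, 4, 1)] 0 8"
  "plan [1, 1, 8, 3, 3, 5, 1, 6, 1, 8] [(- 1, 1, 0), (- 1, 2, 1), (- 1, 7, 1)] (- 4) 2"
  "plan [0, 4, 1, 0, 1, 3, 1, 2, 1, 2] [(- 1, 1, 0), (- 1, 2, 1), (0, 7, 1)] (- 1) 7"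
  "plan [0, 6, 3, 0, 6, 4, 0, 0, 0, 0] [(- 1, 1, 0), (0, 2, 1), (- 1, 3, 1), (- 1, 4, 1)] 0 4"
  "plan [0, 1, 2, 0, 1, 1, 2, 4, 4, 1] [(- 1, 1, 0), (0, 2, 1), (1, 7, 1)] 1 5"
  "plan [2, 2, 2, 5, 2, 2, 5, 2, 2, 5] [(- 1, 1, 0), (- 1, 3, 1), (- 1, 3, 1), (- 1, 3, 1)] (- 3) 3"
  "plan [0, 2, 1, 8, 2, 1, 4, 0, 1, 2] [(- 1, 1, 0), (0, 3, 1), (- 1, 6, 1)] (- 1) 3"
  "plan [6, 0, 6, 0, 6, 0, 0, 5, 1, 0] [(- 1, 1, 0), (- 1, 4, 0), (1, 5, 1)] (- 1) 3"
  "plan [4, 0, 0, 0, 0, 0, 0, 0, 0, 0] [(- 1, 1, 0), (- 1, 4, 1), (- 1, 5, 0)] 1 7"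
  "plan [1, 0, 2, 0, 1, 1, 7, 0, 0, 1] [(- 1, 1, 0), (0, 4, 1), (- 1, 5, 1)] (- 1) 9"
  "plan [6, 6, 0, 6, 0, 1, 1, 1, 2, 1] [(- 1, 1, 0), (0, 4, 1), (1, 5, 1)] 1 7"
  "plan [1, 2, 5, 2, 2, 2, 5, 5, 2, 2] [(- 1, 1, 0), (1, 9, 1)] 1 5"
  "plan [1, 2, 0, 2, 1, 2, 3, 1, 1, 1] [(- 1, 1, 1), (0, 1, 1), (- 1, 2, 0), (- 1, 6, - 1)] (- 4) 2"
  "plan [1, 2, 0, 2, 1, 1, 0, 4, 0, 3] [(- 1, 1, 1), (0, 1, 1), (- 1, 2, 0), (1, 6, 1)] (- 2) 2"
  "plan [2, 2, 0, 2, 3, 3, 8, 4, 8, 1] [(- 1, 1, 1), (0, 1, 1), (- 1, 2, 1), (- 1, 6, 0)] (- 4) 2"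
  "plan [1, 2, 7, 0, 0, 0, 0, 3, 0, 0] [(- 1, 1, 1), (0, 1, 1), (- 1, 2, 1), (- 1, 6, 0)] 0 6"
  "plan [0, 0, 0, 2, 4, 2, 0, 4, 0, 1] [(- 1, 1, 1), (0, 1, 1), (- 1, 2, 1), (- 1, 6, 1)] (- 3) 3"
  "plan [2, 1, 0, 0, 0, 1, 1, 0, 0, 1] [(- 1, 1, 1), (0, 1, 1), (- 1, 3, 0), (- 1, 5, 1)] 0 10"
  "plan [1, 1, 0, 0, 0, 0, 2, 0, 0, 6] [(- 1, 1, 1), (0, 1, 1), (- 1, 3, 1), (- 1, 5, 0)] 0 6"
  "plan [0, 0, 1, 3, 5, 1, 5, 0, 0, 1] [(- 1, 1, 1), (0, 1, 1), (- 1, 3, 1), (- 1, 5, 1)] (- 3) 3"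
  "plan [2, 1, 4, 4, 1, 0, 0, 0, 3, 0] [(- 1, 1, 1), (0, 1, 1), (0, 3, 1), (- 1, 5, - 1)] 0 8"
  "plan [0, 0, 0, 0, 0, 0, 0, 0, 0, 0] [(- 1, 1, 1), (0, 1, 1), (- 1, 4, 1), (- 1, 4, 1)] 1 9"
  "plan [2, 0, 0, 0, 2, 3, 0, 0, 6, 0] [(- 1, 1, 1), (0, 1, 1), (- 1, 8, - 1)] 0 4"
  "plan [7, 8, 2, 5, 0, 0, 1, 1, 0, 1] [(- 1, 1, 1), (0, 1, 1), (- 1, 8, 0)] (- 3) 3"
  "plan [5, 2, 2, 0, 0, 0, 1, 1, 0, 0] [(- 1, 1, 1), (0, 1, 1), (- 1, 8, 0)] (- 1) 7"
  "plan [1, 1, 4, 0, 1, 1, 3, 4, 1, 0] [(- 1, 1, 1), (0, 1, 1), (0, 8, 1)] 1 7"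
  "plan [0, 2, 1, 0, 0, 0, 8, 6, 1, 1] [(- 1, 1, 1), (- 1, 2, 1), (- 1, 3, 0), (0, 4, 1)] 0 8"
  "plan [2, 2, 2, 5, 0, 0, 0, 0, 0, 0] [(- 1, 1, 1), (- 1, 2, 1), (- 1, 3, 1), (- 1, 4, - 1)] 0 4"
  "plan [4, 3, 4, 1, 1, 8, 0, 2, 0, 1] [(- 1, 1, 1), (- 1, 2, 1), (- 1, 3, 1), (- 1, 4, 1)] (- 2) 2"
  "plan [2, 2, 2, 1, 0, 0, 6, 1, 0, 6] [(- 1, 1, 1), (- 1, 2, 1), (1, 3, 1), (- 1, 4, - 1)] (- 2) 2"
  "plan [2, 2, 2, 0, 1, 0, 1, 0, 0, 0] [(- 1, 1, 1), (- 1, 2, 1), (- 1, 7, - 1)] (- 1) 3"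
  "plan [8, 3, 8, 5, 5, 5, 4, 1, 1, 8] [(- 1, 1, 1), (- 1, 2, 1), (- 1, 7, 0)] (- 4) 2"
  "plan [1, 0, 4, 1, 1, 5, 1, 1, 1, 8] [(- 1, 1, 1), (- 1, 2, 1), (- 1, 7, 1)] (- 3) 1"
  "plan [0, 2, 0, 0, 0, 0, 0, 0, 0, 0] [(- 1, 1, 1), (- 1, 2, 1), (- 1, 7, 1)] 1 7"
  "plan [1, 0, 1, 1, 0, 0, 0, 0, 0, 0] [(- 1, 1, 1), (- 1, 2, 1), (1, 7, 1)] (- 1) 3"
  "plan [3, 0, 0, 0, 2, 0, 1, 1, 1, 0] [(- 1, 1, 1), (0, 2, 1), (- 1, 7, - 1)] 0 8"
  "plan [6, 2, 4, 7, 1, 3, 3, 4, 4, 4] [(- 1, 1, 1), (0, 2, 1), (0, 7, 1)] 1 5"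
  "plan [4, 3, 3, 3, 6, 3, 1, 6, 3, 1] [(- 1, 1, 1), (- 1, 3, - 1), (0, 3, 1), (0, 3, 1)] 0 8"
  "plan [0, 0, 0, 0, 2, 2, 2, 2, 2, 2] [(- 1, 1, 1), (- 1, 3, - 1), (1, 6, 1)] 1 5"
  "plan [1, 0, 3, 3, 0, 3, 4, 5, 3, 2] [(- 1, 1, 1), (- 1, 3, 0), (- 1, 3, 1), (0, 3, 1)] 0 6"
  "plan [8, 6, 4, 3, 7, 2, 7, 1, 1, 5] [(- 1, 1, 1), (- 1, 3, 0), (0, 6, 1)] (- 1) 3"
  "plan [0, 1, 0, 0, 3, 2, 3, 1, 1, 6] [(- 1, 1, 1), (0, 3, 1), (- 1, 6, 0)] (- 1) 5"
  "plan [0, 3, 0, 0, 6, 2, 1, 3, 6, 1] [(- 1, 1, 1), (0, 3, 1), (0, 6, 1)] 1 7"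
  "plan [0, 0, 1, 0, 0, 1, 1, 0, 0, 1] [(- 1, 1, 1), (- 1, 4, - 1), (- 1, 5, 1)] (- 3) 3"
  "plan [1, 0, 0, 2, 0, 1, 1, 1, 2, 1] [(- 1, 1, 1), (- 1, 4, - 1), (0, 5, 1)] 0 6"
  "plan [1, 0, 0, 2, 0, 1, 1, 5, 2, 2] [(- 1, 1, 1), (- 1, 4, - 1), (1, 5, 1)] 1 5"
  "plan [8, 3, 6, 6, 1, 1, 1, 1, 1, 1] [(- 1, 1, 1), (- 1, 4, 0), (0, 5, 1)] (- 1) 3"
  "plan [1, 0, 4, 0, 1, 1, 1, 5, 0, 1] [(- 1, 1, 1), (- 1, 4, 1), (- 1, 5, - 1)] (- 3) 3"
  "plan [1, 0, 0, 0, 0, 1, 1, 0, 0, 1] [(- 1, 1, 1), (- 1, 4, 1), (- 1, 5, 1)] 1 5"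
  "plan [2, 0, 1, 6, 3, 1, 1, 1, 2, 1] [(- 1, 1, 1), (0, 4, 1), (0, 5, 1)] 1 5"
  "plan [1, 0, 1, 1, 1, 0, 1, 0, 0, 0] [(- 1, 1, 1), (1, 4, 1), (- 1, 5, - 1)] 1 7"
  "plan [0, 0, 0, 0, 0, 1, 1, 0, 0, 0] [(- 1, 1, 1), (- 1, 9, 1)] (- 2) 4"
  "plan [0, 0, 0, 0, 0, 1, 1, 0, 0, 0] [(- 1, 1, 1), (- 1, 9, 1)] 0 6"
  "plan [1, 0, 5, 1, 2, 2, 5, 5, 2, 1] [(- 1, 1, 1), (0, 9, 1)] 1 7"
  "plan [1, 0, 1, 1, 2, 2, 5, 5, 2, 1] [(- 1, 1, 1), (1, 9, 1)] 2 6"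
  "plan [1, 0, 0, 1, 2, 0, 4, 0, 0, 0] [(0, 1, 1), (1, 1, 1), (- 1, 8, - 1)] 0 6"
  "plan [6, 5, 0, 0, 0, 0, 0, 5, 6, 0] [(0, 1, 1), (1, 1, 1), (- 1, 8, 0)] 1 7"
  "plan [8, 2, 7, 2, 7, 5, 5, 2, 3, 5] [(0, 1, 1), (- 1, 2, 1), (- 1, 2, 1), (- 1, 5, 0)] 0 8"
  "plan [3, 0, 0, 0, 1, 0, 0, 1, 0, 1] [(0, 1, 1), (- 1, 2, 1), (- 1, 3, 0), (- 1, 4, 1)] 0 8"
  "plan [1, 0, 4, 3, 1, 5, 1, 6, 1, 8] [(0, 1, 1), (- 1, 2, 1), (- 1, 7, 1)] (- 4) 2"
  "plan [6, 0, 3, 0, 0, 0, 0, 6, 0, 0] [(0, 1, 1), (- 1, 3, - 1), (- 1, 3, 1), (0, 3, 1)] 0 8"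
  "plan [0, 0, 4, 0, 0, 6, 0, 0, 0, 1] [(0, 1, 1), (- 1, 3, - 1), (- 1, 6, 1)] 0 6"
  "plan [1, 0, 2, 0, 0, 0, 0, 0, 0, 0] [(0, 1, 1), (- 1, 3, - 1), (0, 6, 1)] (- 1) 9"
  "plan [1, 0, 4, 0, 2, 0, 2, 1, 1, 0] [(0, 1, 1), (- 1, 3, 0), (- 1, 6, 1)] (- 1) 7"
  "plan [1, 0, 2, 0, 4, 0, 7, 7, 2, 0] [(0, 1, 1), (- 1, 3, 0), (1, 6, 1)] (- 3) 3"
  "plan [0, 0, 0, 0, 1, 0, 3, 0, 1, 5] [(0, 1, 1), (- 1, 3, 1), (- 1, 6, 0)] (- 1) 5"
  "plan [0, 0, 0, 0, 6, 6, 2, 6, 6, 5] [(0, 1, 1), (- 1, 3, 1), (- 1, 6, 1)] 0 6"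
  "plan [0, 0, 0, 0, 6, 0, 1, 3, 3, 0] [(0, 1, 1), (- 1, 3, 1), (0, 6, 1)] 1 11"
  "plan [0, 4, 0, 0, 0, 6, 0, 1, 6, 0] [(0, 1, 1), (0, 3, 1), (- 1, 6, - 1)] (- 1) 5"
  "plan [0, 0, 0, 0, 0, 0, 0, 3, 0, 0] [(0, 1, 1), (0, 3, 1), (- 1, 6, 1)] 1 7"
  "plan [0, 4, 0, 2, 4, 5, 1, 0, 0, 1] [(0, 1, 1), (- 1, 4, - 1), (- 1, 5, 1)] 0 6"
  "plan [1, 1, 1, 0, 1, 1, 0, 0, 0, 0] [(0, 1, 1), (- 1, 4, 0), (- 1, 5, 1)] (- 1) 7"
  "plan [1, 4, 4, 4, 5, 0, 1, 0, 0, 0] [(0, 1, 1), (- 1, 4, 1), (- 1, 5, - 1)] 0 6"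
  "plan [8, 0, 7, 0, 1, 2, 2, 3, 1, 4] [(0, 1, 1), (- 1, 4, 1), (- 1, 5, 0)] (- 1) 3"
  "plan [1, 0, 1, 0, 1, 1, 1, 0, 0, 1] [(0, 1, 1), (- 1, 4, 1), (- 1, 5, 1)] 0 6"
  "plan [1, 0, 4, 1, 1, 6, 6, 0, 0, 1] [(0, 1, 1), (0, 4, 1), (- 1, 5, 1)] 1 7"
  "plan [1, 0, 3, 0, 4, 1, 1, 0, 2, 0] [(0, 1, 1), (- 1, 9, - 1)] (- 1) 5"
  "plan [0, 0, 0, 0, 3, 0, 0, 6, 0, 0] [(0, 1, 1), (- 1, 9, 1)] 1 7"
  "plan [1, 0, 5, 1, 2, 2, 5, 6, 2, 1] [(0, 1, 1), (1, 9, 1)] 1 11"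
  "plan [6, 0, 0, 7, 1, 1, 7, 7, 7, 1] [(1, 1, 1), (- 1, 2, 0), (0, 7, 1)] 1 9"
  "plan [3, 2, 7, 0, 5, 3, 4, 1, 4, 8] [(1, 1, 1), (- 1, 2, 1), (- 1, 3, 0), (- 1, 4, 0)] 0 6"
  "plan [4, 0, 3, 0, 0, 3, 6, 8, 0, 0] [(1, 1, 1), (- 1, 3, - 1), (- 1, 3, 0), (0, 3, 1)] 0 8"
  "plan [7, 0, 0, 4, 6, 6, 1, 3, 3, 1] [(1, 1, 1), (- 1, 3, 0), (0, 6, 1)] 1 9"
  "plan [0, 0, 3, 1, 0, 0, 0, 3, 0, 6] [(1, 1, 1), (0, 3, 1), (- 1, 6, 0)] 1 7"
  "plan [8, 0, 0, 0, 4, 8, 1, 1, 2, 1] [(1, 1, 1), (- 1, 4, 0), (0, 5, 1)] 1 5"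
  "plan [1, 4, 1, 1, 1, 0, 0, 3, 0, 0] [(1, 1, 1), (0, 4, 1), (- 1, 5, 0)] 1 9"
  "plan [0, 0, 0, 0, 3, 0, 0, 6, 0, 0] [(1, 1, 1), (- 1, 9, 1)] 2 6"
  "plan [0, 0, 0, 0, 2, 0, 0, 6, 0, 0] [(1, 1, 1), (0, 9, 1)] 1 7"
  "plan [0, 6, 0, 6, 0, 1, 0, 2, 0, 3] [(- 1, 2, 0), (- 1, 4, 1), (0, 4, 1)] (- 1) 7"
  "plan [2, 2, 2, 2, 0, 0, 2, 0, 4, 0] [(- 1, 2, 1), (- 1, 2, 1), (- 1, 6, - 1)] (- 3) 3"
  "plan [1, 0, 1, 0, 0, 0, 0, 3, 0, 0] [(- 1, 2, 1), (- 1, 2, 1), (- 1, 6, 1)] 1 9"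
  "plan [1, 1, 0, 0, 0, 1, 7, 3, 1, 6] [(- 1, 2, 1), (- 1, 3, - 1), (- 1, 5, 1)] (- 1) 3"
  "plan [1, 6, 0, 6, 0, 1, 1, 1, 2, 1] [(- 1, 2, 1), (- 1, 3, - 1), (1, 5, 1)] 1 7"
  "plan [0, 0, 1, 6, 0, 7, 6, 8, 1, 7] [(- 1, 2, 1), (- 1, 3, 0), (0, 5, 1)] (- 1) 7"
  "plan [1, 0, 4, 0, 0, 4, 0, 0, 0, 0] [(- 1, 2, 1), (- 1, 3, 1), (- 1, 5, 1)] 1 7"
  "plan [1, 6, 8, 1, 7, 7, 1, 5, 0, 6] [(- 1, 2, 1), (0, 3, 1), (- 1, 5, 0)] (- 1) 3"
  "plan [0, 2, 0, 1, 0, 0, 0, 0, 0, 0] [(- 1, 2, 1), (- 1, 4, - 1), (- 1, 4, 1)] (- 3) 3"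
  "plan [1, 2, 0, 0, 0, 0, 0, 5, 5, 2] [(- 1, 2, 1), (- 1, 4, - 1), (1, 4, 1)] 1 9"
  "plan [0, 0, 0, 0, 0, 0, 0, 0, 0, 0] [(- 1, 2, 1), (- 1, 4, 1), (- 1, 4, 1)] 1 7"
  "plan [0, 1, 0, 0, 0, 0, 0, 0, 0, 0] [(- 1, 2, 1), (- 1, 8, 1)] (- 2) 4"
  "plan [0, 0, 0, 0, 0, 0, 0, 0, 0, 0] [(- 1, 2, 1), (- 1, 8, 1)] 0 8"
  "plan [1, 1, 0, 0, 0, 6, 1, 2, 6, 6] [(0, 2, 1), (0, 3, 1), (- 1, 5, 1)] 1 7"
  "plan [3, 3, 3, 2, 2, 8, 0, 4, 0, 1] [(- 1, 3, - 1), (- 1, 3, 1), (- 1, 4, 1)] (- 3) 3"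
  "plan [0, 0, 0, 3, 0, 3, 2, 1, 2, 0] [(- 1, 3, - 1), (1, 7, 1)] 0 8"
  "plan [0, 0, 2, 0, 0, 2, 0, 0, 0, 0] [(- 1, 3, 0), (- 1, 3, 0), (- 1, 4, 1)] 1 7"
  "plan [0, 2, 2, 0, 2, 2, 0, 0, 0, 0] [(- 1, 3, 1), (- 1, 3, 1), (- 1, 4, 1)] 1 9"
  "plan [0, 0, 0, 3, 0, 3, 0, 0, 1, 0] [(- 1, 3, 1), (- 1, 7, 1)] 0 4"
  "plan [0, 0, 0, 3, 6, 1, 2, 4, 6, 1] [(- 1, 3, 1), (1, 7, 1)] 2 6"
  "plan [0, 1, 0, 0, 2, 2, 4, 0, 1, 2] [(- 1, 4, - 1), (- 1, 6, 1)] (- 2) 2"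
  "plan [0, 0, 0, 0, 2, 0, 2, 2, 2, 0] [(- 1, 4, - 1), (1, 6, 1)] 0 4"
  "plan [0, 0, 2, 1, 0, 0, 2, 0, 4, 0] [(- 1, 4, 0), (- 1, 6, - 1)] 1 9"
  "plan [0, 2, 0, 1, 4, 0, 8, 8, 2, 0] [(- 1, 4, 0), (1, 6, 1)] (- 3) 3"
  "plan [0, 2, 0, 1, 0, 2, 8, 8, 1, 0] [(- 1, 4, 1), (- 1, 6, - 1)] (- 4) 2"
  "plan [0, 2, 0, 1, 0, 2, 8, 8, 1, 0] [(- 1, 4, 1), (- 1, 6, - 1)] (- 2) 2"
  "plan [0, 0, 0, 0, 2, 0, 3, 0, 1, 0] [(- 1, 4, 1), (- 1, 6, 1)] 0 4"
  "plan [0, 2, 0, 1, 4, 0, 4, 0, 4, 0] [(- 1, 4, 1), (1, 6, 1)] (- 2) 2"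
  "plan [1, 6, 0, 6, 1, 1, 0, 4, 1, 0] [(- 1, 5, - 1), (1, 5, 1)] 0 6"
  "plan [0, 0, 2, 0, 8, 0, 0, 2, 0, 8] [(- 1, 5, 0), (- 1, 5, 0)] 0 10"
  "plan [1, 0, 0, 0, 0, 1, 0, 0, 0, 0] [(- 1, 5, 1), (- 1, 5, 1)] (- 2) 4"
  "plan [1, 0, 0, 0, 0, 1, 0, 0, 0, 0] [(- 1, 5, 1), (- 1, 5, 1)] 0 6"
  "plan [6, 6, 0, 0, 1, 1, 1, 4, 2, 2] [(- 1, 5, 1), (1, 5, 1)] 2 8"
  "plan [0, 0, 0, 1, 0, 0, 7, 0, 0, 0] [(- 1, 10, - 1)] 1 7"
  "plan [0, 1, 0, 0, 0, 0, 0, 0, 0, 1] [(- 1, 10, 1)] (- 3) 3"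
  "plan [0, 0, 1, 1, 2, 0, 1, 2, 1, 0] [(1, 10, 1)] 1 7"
  by (rule planI; simp add: respond_def cuts_def upto_rec1 safe_Nil safe_2 safe_4 safe_6 safe_8)+

lemmas safe_10 = plan_10[THEN plan_weaken]

lemma plan_12:
  "plan [1, 7, 0, 2, 0, 0, 0, 0, 0, 0, 1, 0] [(- 1, 1, - 1), (- 1, 11, 1)] 0 4"
  "plan [3, 0, 0, 1, 6, 3, 1, 3, 1, 1, 1, 7] [(- 1, 1, 0), (- 1, 1, 1), (0, 1, 1), (- 1, 2, 1), (- 1, 7, 1)] (- 3) 3"
  "plan [3, 2, 0, 6, 7, 2, 10, 10, 2, 3, 2, 10] [(- 1, 1, 0), (- 1, 1, 1), (- 1, 2, 1), (0, 8, 1)] (- 2) 2"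
  "plan [4, 5, 1, 2, 3, 8, 5, 1, 2, 0, 0, 1] [(- 1, 1, 0), (- 1, 1, 1), (0, 2, 1), (- 1, 3, 1), (- 1, 5, 1)] (- 1) 3"
  "plan [1, 1, 9, 1, 6, 3, 3, 3, 6, 6, 3, 3] [(- 1, 1, 0), (- 1, 1, 1), (0, 10, 1)] 1 9"
  "plan [1, 0, 0, 0, 5, 2, 2, 2, 5, 5, 2, 2] [(- 1, 1, 0), (- 1, 2, 0), (1, 9, 1)] 1 7"
  "plan [0, 1, 8, 8, 1, 2, 2, 3, 5, 5, 6, 2] [(- 1, 1, 0), (- 1, 2, 1), (0, 9, 1)] 1 9"
  "plan [0, 1, 2, 0, 5, 2, 0, 0, 0, 0, 8, 2] [(- 1, 1, 0), (0, 2, 1), (- 1, 9, 1)] 1 9"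
  "plan [4, 4, 2, 10, 2, 5, 0, 0, 0, 0, 5, 10] [(- 1, 1, 0), (0, 2, 1), (1, 9, 1)] (- 1) 3"
  "plan [3, 0, 0, 0, 7, 4, 8, 2, 4, 8, 8, 2] [(- 1, 1, 0), (- 1, 3, 1), (0, 8, 1)] 1 5"
  "plan [0, 2, 1, 1, 0, 0, 0, 0, 0, 0, 0, 0] [(- 1, 1, 0), (0, 3, 1), (- 1, 4, 1), (- 1, 4, 1)] 2 10"
  "plan [0, 2, 1, 1, 4, 0, 0, 0, 4, 0, 0, 0] [(- 1, 1, 0), (0, 3, 1), (- 1, 8, 1)] 1 9"
  "plan [5, 8, 1, 0, 0, 1, 5, 2, 2, 2, 3, 2] [(- 1, 1, 0), (- 1, 5, 1), (0, 6, 1)] 1 9"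
  "plan [2, 1, 1, 5, 2, 2, 0, 0, 2, 0, 1, 5] [(- 1, 1, 0), (1, 5, 1), (- 1, 6, 0)] 1 7"
  "plan [4, 10, 7, 3, 0, 1, 7, 7, 3, 0, 2, 2] [(- 1, 1, 0), (- 1, 11, 1)] (- 3) 3"
  "plan [0, 0, 1, 1, 4, 3, 2, 1, 2, 2, 3, 1] [(- 1, 1, 0), (0, 11, 1)] 0 8"
  "plan [1, 2, 3, 2, 4, 4, 7, 1, 6, 0, 0, 1] [(- 1, 1, 1), (0, 1, 1), (- 1, 2, 0), (- 1, 3, 1), (- 1, 5, 1)] (- 1) 3"
  "plan [9, 10, 3, 9, 9, 9, 5, 2, 2, 0, 1, 5] [(- 1, 1, 1), (0, 1, 1), (- 1, 2, 1), (- 1, 3, 1), (- 1, 5, 0)] (- 1) 3"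
  "plan [3, 2, 1, 0, 2, 4, 2, 2, 2, 1, 1, 2] [(- 1, 1, 1), (0, 1, 1), (- 1, 4, 0), (1, 6, 1)] 0 4"
  "plan [5, 3, 5, 10, 2, 9, 5, 6, 8, 6, 6, 7] [(- 1, 1, 1), (- 1, 2, 1), (0, 4, 1), (- 1, 5, 0)] (- 2) 2"
  "plan [4, 4, 6, 4, 9, 10, 3, 1, 9, 6, 1, 10] [(- 1, 1, 1), (- 1, 3, 0), (0, 8, 1)] (- 3) 3"
  "plan [1, 0, 0, 3, 10, 1, 1, 1, 3, 4, 1, 1] [(- 1, 1, 1), (- 1, 3, 0), (0, 8, 1)] 1 11"
  "plan [1, 10, 7, 1, 0, 0, 0, 3, 0, 5, 0, 8] [(- 1, 1, 1), (0, 3, 1), (- 1, 8, 0)] 1 9"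
  "plan [1, 0, 1, 0, 0, 2, 3, 0, 0, 0, 0, 3] [(- 1, 1, 1), (- 1, 4, - 1), (1, 7, 1)] (- 1) 3"
  "plan [4, 10, 2, 4, 8, 9, 2, 0, 1, 5, 0, 9] [(- 1, 1, 1), (- 1, 4, 0), (0, 7, 1)] (- 3) 3"
  "plan [1, 0, 0, 0, 0, 5, 3, 0, 0, 0, 0, 1] [(- 1, 1, 1), (- 1, 4, 1), (- 1, 7, 1)] (- 1) 3"
  "plan [1, 0, 0, 0, 0, 5, 10, 2, 1, 6, 3, 1] [(- 1, 1, 1), (- 1, 5, 0), (0, 6, 1)] 1 9"
  "plan [3, 1, 1, 1, 5, 1, 0, 0, 0, 8, 4, 6] [(- 1, 1, 1), (0, 5, 1), (- 1, 6, 0)] 1 7"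
  "plan [3, 1, 2, 0, 0, 5, 1, 1, 7, 0, 1, 1] [(- 1, 1, 1), (- 1, 11, - 1)] 0 4"
  "plan [10, 9, 2, 9, 0, 9, 9, 1, 9, 9, 2, 2] [(- 1, 1, 1), (- 1, 11, 0)] (- 3) 3"
  "plan [4, 1, 2, 3, 0, 1, 1, 1, 1, 0, 1, 2] [(- 1, 1, 1), (- 1, 11, 1)] (- 2) 2"
  "plan [0, 0, 0, 0, 0, 4, 0, 0, 7, 0, 0, 0] [(- 1, 1, 1), (- 1, 11, 1)] 2 8"
  "plan [2, 1, 1, 0, 1, 2, 0, 0, 7, 2, 0, 2] [(- 1, 1, 1), (1, 11, 1)] 0 4"
  "plan [1, 0, 1, 2, 10, 3, 3, 5, 1, 7, 1, 10] [(0, 1, 1), (- 1, 2, 0), (- 1, 2, 1), (- 1, 7, 1)] (- 4) 2"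
  "plan [3, 0, 0, 0, 4, 0, 1, 8, 3, 8, 8, 0] [(0, 1, 1), (- 1, 3, - 1), (0, 8, 1)] 1 9"
  "plan [1, 0, 0, 0, 0, 0, 0, 0, 0, 0, 0, 0] [(0, 1, 1), (- 1, 3, 0), (- 1, 4, 1), (- 1, 4, 1)] 2 10"
  "plan [2, 0, 0, 2, 4, 0, 0, 0, 4, 0, 0, 0] [(0, 1, 1), (- 1, 3, 0), (- 1, 8, 1)] 1 11"
  "plan [9, 0, 0, 0, 8, 0, 0, 3, 8, 5, 8, 0] [(0, 1, 1), (- 1, 3, 1), (- 1, 8, 0)] 1 9"
  "plan [0, 0, 0, 0, 0, 0, 0, 3, 0, 0, 6, 0] [(0, 1, 1), (0, 3, 1), (- 1, 8, - 1)] 1 9"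
  "plan [5, 0, 0, 0, 3, 0, 6, 0, 1, 6, 3, 0] [(0, 1, 1), (- 1, 5, - 1), (0, 6, 1)] 1 11"
  "plan [3, 0, 0, 2, 3, 0, 6, 0, 0, 0, 0, 0] [(0, 1, 1), (- 1, 5, 0), (- 1, 6, 1)] 1 11"
  "plan [4, 2, 2, 0, 0, 4, 4, 0, 9, 9, 2, 0] [(0, 1, 1), (- 1, 5, 0), (1, 6, 1)] (- 1) 3"
  "plan [9, 9, 0, 0, 0, 0, 0, 0, 3, 3, 4, 0] [(0, 1, 1), (- 1, 5, 1), (- 1, 6, 0)] 1 9"
  "plan [1, 0, 0, 0, 3, 4, 0, 0, 0, 0, 9, 0] [(0, 1, 1), (- 1, 11, - 1)] 1 7"
  "plan [1, 1, 1, 0, 1, 0, 0, 0, 0, 8, 0, 0] [(0, 1, 1), (- 1, 11, 0)] 0 8"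
  "plan [4, 7, 10, 3, 0, 1, 1, 7, 1, 0, 1, 2] [(0, 1, 1), (- 1, 11, 1)] (- 3) 3"
  "plan [0, 0, 0, 2, 7, 0, 0, 0, 0, 8, 4, 0] [(0, 1, 1), (- 1, 11, 1)] 1 11"
  "plan [0, 0, 0, 1, 7, 3, 4, 1, 6, 8, 8, 0] [(0, 1, 1), (0, 11, 1)] 2 12"
  "plan [1, 8, 2, 0, 2, 10, 1, 1, 3, 4, 4, 1] [(- 1, 2, 1), (- 1, 3, 0), (0, 7, 1)] 1 9"
  "plan [1, 8, 4, 0, 3, 0, 6, 10, 1, 1, 6, 1] [(- 1, 2, 1), (- 1, 5, 0), (0, 5, 1)] 1 9"
  "plan [1, 1, 0, 1, 0, 0, 4, 0, 0, 0, 0, 0] [(- 1, 2, 1), (- 1, 10, - 1)] (- 2) 4"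
  "plan [1, 8, 9, 0, 0, 0, 0, 0, 0, 0, 0, 0] [(- 1, 2, 1), (- 1, 10, 1)] 2 10"
  "plan [0, 2, 0, 5, 2, 3, 8, 5, 1, 3, 3, 1] [(- 1, 3, - 1), (0, 3, 1), (0, 6, 1)] 1 9"
  "plan [2, 2, 2, 0, 0, 0, 7, 5, 2, 8, 3, 3] [(- 1, 3, 0), (- 1, 3, 1), (0, 6, 1)] 1 9"
  "plan [0, 0, 2, 4, 5, 1, 5, 5, 0, 3, 0, 1] [(- 1, 3, 0), (0, 3, 1), (- 1, 6, 1)] 1 9"
  "plan [0, 0, 3, 5, 3, 1, 1, 8, 1, 0, 0, 1] [(- 1, 3, 0), (0, 4, 1), (- 1, 5, 1)] 1 11"
  "plan [1, 8, 0, 10, 2, 1, 5, 1, 3, 1, 3, 1] [(- 1, 3, 0), (0, 9, 1)] 0 8"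
  "plan [0, 0, 0, 10, 2, 1, 5, 5, 0, 5, 5, 8] [(- 1, 3, 1), (0, 3, 1), (- 1, 6, 0)] 1 7"
  "plan [0, 0, 0, 0, 0, 3, 0, 0, 0, 0, 8, 0] [(- 1, 3, 1), (- 1, 9, 1)] 2 10"
  "plan [0, 0, 0, 0, 0, 1, 0, 0, 0, 0, 8, 0] [(- 1, 3, 1), (0, 9, 1)] 1 11"
  "plan [10, 1, 1, 0, 0, 0, 0, 4, 1, 2, 0, 4] [(0, 3, 1), (- 1, 4, 1), (- 1, 5, 0)] 1 9"
  "plan [10, 2, 6, 1, 5, 0, 0, 8, 1, 6, 0, 8] [(0, 3, 1), (- 1, 9, 0)] 0 8"
  "plan [0, 0, 0, 8, 5, 1, 2, 8, 5, 6, 6, 1] [(0, 3, 1), (0, 9, 1)] 2 8"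
  "plan [1, 1, 0, 3, 4, 1, 1, 5, 4, 7, 4, 1] [(- 1, 4, 0), (0, 8, 1)] 0 8"
  "plan [0, 0, 0, 0, 4, 0, 0, 0, 0, 0, 0, 0] [(- 1, 4, 1), (- 1, 8, 1)] 2 10"
  "plan [3, 1, 1, 1, 4, 1, 1, 8, 4, 5, 5, 1] [(0, 4, 1), (0, 8, 1)] 2 10"
  "plan [0, 1, 0, 0, 0, 3, 6, 0, 1, 6, 0, 1] [(- 1, 5, - 1), (- 1, 7, 1)] (- 2) 4"
  "plan [0, 0, 0, 3, 0, 0, 1, 6, 2, 6, 4, 2] [(- 1, 5, - 1), (1, 7, 1)] 2 10"
  "plan [3, 3, 3, 0, 1, 10, 10, 10, 10, 10, 10, 10] [(- 1, 5, 0), (- 1, 7, 1)] (- 3) 3"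
  "plan [4, 4, 0, 0, 1, 0, 1, 0, 0, 0, 0, 0] [(- 1, 5, 1), (- 1, 7, - 1)] (- 2) 4"
  "plan [10, 10, 0, 0, 1, 5, 5, 5, 5, 5, 8, 10] [(- 1, 5, 1), (- 1, 7, 0)] (- 3) 3"
  "plan [1, 3, 0, 0, 1, 3, 3, 5, 1, 7, 1, 10] [(- 1, 5, 1), (- 1, 7, 1)] (- 2) 2"
  "plan [8, 0, 0, 0, 0, 0, 0, 0, 0, 0, 0, 0] [(- 1, 5, 1), (- 1, 7, 1)] 2 10"
  "plan [1, 1, 4, 2, 2, 0, 0, 0, 0, 1, 5, 0] [(1, 5, 1), (- 1, 7, - 1)] 2 10"
  "plan [1, 8, 0, 1, 1, 5, 9, 2, 1, 1, 1, 1] [(- 1, 6, 0), (0, 6, 1)] 0 10"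
  "plan [5, 8, 2, 3, 3, 3, 5, 8, 2, 3, 3, 3] [(0, 6, 1), (0, 6, 1)] 2 10"
  "plan [0, 8, 0, 1, 0, 0, 0, 0, 0, 1, 0, 1] [(- 1, 12, 1)] 1 7"
  "plan [0, 1, 1, 2, 8, 5, 5, 2, 7, 9, 9, 1] [(1, 12, 1)] 3 9"
  by (rule planI; simp add: respond_def cuts_def upto_rec1 safe_Nil safe_2 safe_4 safe_6 safe_8 safe_10)+

lemmas safe_12 = plan_12[THEN plan_weaken]

lemma plan_14:
  "plan [1, 3, 11, 2, 3, 1, 5, 3, 2, 8, 2, 8, 1, 8] [(- 1, 1, 0), (- 1, 1, 1), (0, 12, 1)] (- 1) 3"
  "plan [0, 12, 1, 2, 2, 3, 9, 6, 6, 3, 8, 9, 10, 2] [(- 1, 1, 0), (0, 13, 1)] 2 10"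
  "plan [11, 12, 9, 2, 9, 1, 9, 9, 1, 9, 9, 3, 1, 12] [(- 1, 1, 1), (0, 1, 1), (- 1, 12, 0)] (- 3) 3"
  "plan [6, 6, 2, 6, 0, 5, 12, 9, 11, 1, 1, 1, 1, 4] [(- 1, 1, 1), (- 1, 5, 0), (0, 8, 1)] (- 1) 3"
  "plan [1, 0, 1, 11, 7, 3, 0, 11, 1, 7, 1, 0, 3, 2] [(0, 1, 1), (- 1, 2, 0), (- 1, 11, 1)] (- 3) 3"
  "plan [1, 11, 11, 8, 8, 8, 8, 8, 1, 8, 8, 0, 1, 10] [(0, 1, 1), (- 1, 2, 1), (- 1, 11, 0)] (- 3) 3"
  "plan [12, 1, 11, 3, 1, 11, 5, 5, 5, 5, 5, 1, 10, 7] [(0, 1, 1), (- 1, 5, 1), (- 1, 8, 0)] (- 3) 3"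
  "plan [5, 3, 3, 3, 0, 1, 5, 11, 11, 11, 11, 11, 11, 11] [(0, 1, 1), (- 1, 6, 0), (- 1, 7, 1)] (- 3) 3"
  "plan [3, 0, 0, 3, 3, 0, 5, 0, 0, 8, 0, 10, 11, 0] [(0, 1, 1), (- 1, 13, 0)] 2 12"
  "plan [0, 0, 2, 12, 10, 1, 7, 3, 4, 1, 6, 7, 8, 1] [(- 1, 3, 0), (0, 11, 1)] 2 14"
  "plan [12, 2, 1, 0, 0, 0, 3, 0, 0, 10, 0, 8, 0, 10] [(0, 3, 1), (- 1, 11, 0)] 2 10"
  "plan [0, 0, 3, 0, 0, 12, 5, 1, 8, 3, 5, 5, 6, 1] [(- 1, 5, 0), (0, 9, 1)] 2 12"
  "plan [0, 0, 3, 3, 0, 5, 12, 1, 1, 11, 3, 7, 5, 1] [(- 1, 6, 0), (0, 8, 1)] 2 10"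
  "plan [12, 9, 1, 5, 3, 1, 0, 0, 0, 3, 0, 5, 0, 7] [(0, 6, 1), (- 1, 8, 0)] 2 14"
  "plan [1, 10, 0, 1, 5, 12, 0, 12, 0, 1, 12, 12, 0, 1] [(- 1, 14, 1)] (- 3) 3"
  "plan [0, 0, 0, 0, 0, 0, 0, 7, 0, 0, 0, 0, 0, 0] [(- 1, 14, 1)] 3 13"
  "plan [11, 12, 0, 4, 5, 12, 0, 12, 0, 7, 8, 12, 0, 1] [(0, 14, 0)] (- 3) 3"
  by (rule planI; simp add: respond_def cuts_def upto_rec1 safe_Nil safe_2 safe_4 safe_6 safe_8 safe_10 safe_12)+

lemmas safe_14 = plan_14[THEN plan_weaken]

text \<open>Two different strategies from the blank path, one for each bound. In both, a move at an
  endpoint is answered at the opposite endpoint: these are the entries \<open>14\<close> and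
  \<open>0\<close> at the ends of the lists.\<close>

lemma plan_16:
  "plan [14, 2, 13, 1, 1, 6, 13, 1, 13, 1, 8, 13, 13, 1, 12, 0] [(0, 16, 0)] (- 3) 3"
  "plan [14, 1, 1, 3, 3, 5, 6, 6, 8, 8, 9, 11, 11, 13, 13, 0] [(0, 16, 0)] 3 15"
  by (rule planI; simp add: respond_def cuts_def upto_rec1 safe_Nil safe_2 safe_4 safe_6 safe_8 safe_10 safe_12 safe_14)+

lemmas safe_16 = plan_16[THEN plan_weaken]

section \<open>One additional vertex\<close>

lemma fill_iff_update: "fill x w w' \<longleftrightarrow> (\<exists>i<length w. w ! i = 0 \<and> w' = w[i := x])"
proof
  assume "fill x w w'"
  then obtain u v where "w = u @ 0 # v" "w' = u @ x # v" by (auto simp: fill_def)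
  then show "\<exists>i<length w. w ! i = 0 \<and> w' = w[i := x]"
    by (intro exI[of _ "length u"]) simp
next
  assume "\<exists>i<length w. w ! i = 0 \<and> w' = w[i := x]"
  then obtain i where "i < length w" "w ! i = 0" "w' = w[i := x]" by blast
  then show "fill x w w'"
    unfolding fill_def by (metis id_take_nth_drop upd_conv_take_nth_drop)
qed

lemma fill_singleton: "fill x [a] v \<longleftrightarrow> a = 0 \<and> v = [x]"
  by (auto simp: fill_iff_update)

text \<open>Lets a secret fill be treated as if it came after the opponent's next move. Since
  \<open>x \<noteq> 0\<close>, the second fill hits another cell.\<close>

lemma fill_commute:
  assumes "fill x w w\<^sub>1" "fill y w\<^sub>1 w\<^sub>2" "x \<noteq> 0"
  shows "\<exists>w'. fill y w w' \<and> fill x w' w\<^sub>2"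
proof -
  obtain i where i: "i < length w" "w ! i = 0" "w\<^sub>1 = w[i := x]"
    using assms(1) by (auto simp: fill_iff_update)
  obtain j where j: "j < length w" "w[i := x] ! j = 0" "w\<^sub>2 = w[i := x, j := y]"
    using assms(2) i(3) by (auto simp: fill_iff_update)
  have "i \<noteq> j" using i j assms(3) by auto
  with i j show ?thesis
    unfolding fill_iff_update by (intro exI[of _ "w[j := y]"] conjI exI[of _ j] exI[of _ i])
      (auto simp: list_update_swap)
qed

text \<open>Compares the secretly filled cell with the cell that the strategy asks for.\<close>

lemma fill_diamond:
  assumes "fill x w a" "fill x w b"
  shows "a = b \<or> (\<exists>z. fill x a z \<and> fill x b z)"
proof -
  obtain i where i: "i < length w" "w ! i = 0" "a = w[i := x]"
    using assms(1) by (auto simp: fill_iff_update)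
  obtain j where j: "j < length w" "w ! j = 0" "b = w[j := x]"
    using assms(2) by (auto simp: fill_iff_update)
  show ?thesis
  proof (cases "i = j")
    case False
    with i j have "fill x a (w[i := x, j := x])" "fill x b (w[i := x, j := x])"
      unfolding fill_iff_update by (auto simp: list_update_swap[of i j])
    then show ?thesis by blast
  qed (use i j in simp)
qed

text \<open>Unlike forces, this also covers an odd number of blanks, where the opponent makes the last move.\<close>

inductive controls :: "int \<Rightarrow> int \<Rightarrow> int list \<Rightarrow> bool" for lo hi where
  full: "0 \<notin> set w \<Longrightarrow> lo \<le> score w \<Longrightarrow> score w \<le> hi \<Longrightarrow> controls lo hi w"
| turn: "0 \<in> set w \<Longrightarrow>
    (\<And>w'. fill (- 1) w w' \<Longrightarrow>
      0 \<notin> set w' \<and> lo \<le> score w' \<and> score w' \<le> hi \<or> (\<exists>w''. fill 1 w' w'' \<and> controls lo hi w'')) \<Longrightarrow>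
    controls lo hi w"

lemma holds_imp_controls: "holds lo hi w \<Longrightarrow> controls lo hi w"
proof (induction rule: forces.induct)
  case (final w)
  then show ?case using ex_fill by (intro controls.full) blast+
next
  case (turn w w\<^sub>0)
  show ?case
  proof (rule controls.turn)
    show "0 \<in> set w" using turn.hyps(1) ex_fill by blast
  qed (drule turn.IH, blast)
qed

lemma holds_fullD: "holds lo hi w \<Longrightarrow> 0 \<notin> set w \<Longrightarrow> lo \<le> score w \<and> score w \<le> hi"
  by (erule forces.cases) (use ex_fill in blast)+

text \<open>In the second conjunct the opponent has taken the extra cell, and the replying player has secretly
  filled a cell that she still treats as blank.\<close>

lemma controls_extra:
  assumes "holds lo hi w" "set w \<subseteq> {- 1, 0, 1}"
  shows "controls (lo - 1) (hi + 1) (w @ [0]) \<and>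
    (\<forall>w'. fill 1 w w' \<longrightarrow> controls (lo - 1) (hi + 1) (w' @ [- 1]))"
  using assms
proof (induction rule: forces.induct)
  case (final w)
  then have "0 \<notin> set w" using ex_fill by blast
  then have no: "\<not> fill x w w'" for x w' using ex_fill by blast
  have "controls (lo - 1) (hi + 1) (w @ [0])"
  proof (rule controls.turn)
    fix r assume "fill (- 1) (w @ [0]) r"
    \<comment> \<open>Only the extra cell is left, and the opponent ends the game by taking
      it.\<close>
    then have "r = w @ [- 1]"
      using no by (auto simp: fill_append fill_singleton)
    then show "0 \<notin> set r \<and> lo - 1 \<le> score r \<and> score r \<le> hi + 1 \<or>
        (\<exists>w''. fill 1 r w'' \<and> controls (lo - 1) (hi + 1) w'')"
      using \<open>0 \<notin> set w\<close> final score_append_bounds[of w "[- 1]"] by auto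
  qed simp
  then show ?case using no by blast
next
  case (turn w w\<^sub>0)
  have cells: "set w'' \<subseteq> {- 1, 0, 1}" if "fill (- 1) w w'" "fill 1 w' w''" for w' w''
    using turn.prems fill_set[OF that(1)] fill_set[OF that(2)] by auto
  have reply: "\<exists>w''. fill 1 w' w'' \<and> holds lo hi w'' \<and> set w'' \<subseteq> {- 1, 0, 1} \<and>
      controls (lo - 1) (hi + 1) (w'' @ [0]) \<and>
      (\<forall>z. fill 1 w'' z \<longrightarrow> controls (lo - 1) (hi + 1) (z @ [- 1]))" if "fill (- 1) w w'" for w'
    using turn.IH[OF that] cells[OF that] by blast
  have B: "controls (lo - 1) (hi + 1) (w\<^sub>1 @ [- 1])" if w1: "fill 1 w w\<^sub>1" for w\<^sub>1
  proof -
    have step: "0 \<notin> set r \<and> lo - 1 \<le> score r \<and> score r \<le> hi + 1 \<or>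
        (\<exists>w''. fill 1 r w'' \<and> controls (lo - 1) (hi + 1) w'')" if r: "fill (- 1) (w\<^sub>1 @ [- 1]) r" for r
    proof -
      obtain w\<^sub>2 where w2: "fill (- 1) w\<^sub>1 w\<^sub>2" "r = w\<^sub>2 @ [- 1]"
        using r by (auto simp: fill_append fill_singleton)
      \<comment> \<open>The opponent's move is put before the secret fill, so that the strategy for
        \<open>w\<close> can answer it by \<open>w''\<close>.\<close>
      obtain w' where w': "fill (- 1) w w'" "fill 1 w' w\<^sub>2"
        using fill_commute[OF w1 w2(1)] by auto
      obtain w'' where w'': "fill 1 w' w''" "holds lo hi w''" "set w'' \<subseteq> {- 1, 0, 1}"
        "\<And>z. fill 1 w'' z \<Longrightarrow> controls (lo - 1) (hi + 1) (z @ [- 1])"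
        using reply[OF w'(1)] by blast
      show ?thesis
      \<comment> \<open>In the first case the strategy asks for the secret cell when nothing else is
        blank: the game is over, with the word that the strategy wants.\<close>
      proof (cases "w'' = w\<^sub>2 \<and> 0 \<notin> set w''")
        case True
        then show ?thesis
          using w2(2) holds_fullD[OF w''(2)] score_append_bounds[OF w''(3), of "[- 1]"] by auto
      next
        \<comment> \<open>\<open>z\<close> fills the cell asked for or, if that is the secret cell,
          any other blank, which becomes the new secret cell.\<close>
        case False
        then obtain z where "fill 1 w\<^sub>2 z" "fill 1 w'' z"
          using fill_diamond[OF w'(2) w''(1)] ex_fill by blast
        then show ?thesis
          using w''(4) w2(2) by (intro disjI2 exI[of _ "z @ [- 1]"]) (auto simp: fill_append)
      qed
    qed
    \<comment> \<open>If the opponent took the secret cell in \<open>w\<close>, the strategy would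
      still have a reply; its cell differs from the secret one and is blank here too.\<close>
    have "0 \<in> set w\<^sub>1"
    proof (rule ccontr)
      assume no: "0 \<notin> set w\<^sub>1"
      obtain i where i: "i < length w" "w ! i = 0" "w\<^sub>1 = w[i := 1]"
        using w1 by (auto simp: fill_iff_update)
      then have "fill (- 1) w (w[i := - 1])" by (auto simp: fill_iff_update)
      from reply[OF this] obtain j where "j < length w" "w[i := - 1] ! j = 0"
        by (auto simp: fill_iff_update)
      then have "w\<^sub>1 ! j = 0" "j < length w\<^sub>1" using i by (cases "i = j"; simp)+
      with no show False by (metis nth_mem)
    qed
    then show ?thesis using step by (intro controls.turn) auto
  qed
  have "controls (lo - 1) (hi + 1) (w @ [0])"
  proof (rule controls.turn)
    fix r assume "fill (- 1) (w @ [0]) r"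
    then consider w' where "fill (- 1) w w'" "r = w' @ [0]" | "r = w @ [- 1]"
      by (auto simp: fill_append fill_singleton)
    then have "\<exists>w''. fill 1 r w'' \<and> controls (lo - 1) (hi + 1) w''"
    proof cases
      case 1
      with reply[OF 1(1)] show ?thesis by (auto simp: fill_append)
    next
      case 2
      obtain w\<^sub>1 where "fill 1 w w\<^sub>1" using turn.hyps(1) ex_fill by blast
      with B 2 show ?thesis by (auto simp: fill_append)
    qed
    then show "0 \<notin> set r \<and> lo - 1 \<le> score r \<and> score r \<le> hi + 1 \<or>
        (\<exists>w''. fill 1 r w'' \<and> controls (lo - 1) (hi + 1) w'')" by blast
  qed simp
  then show ?case using B by blast
qed

section \<open>The cordiality game on paths\<close>

text \<open>\<open>r\<close> is the label used by the replying player: 0 for Admirable, 1 for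
  Impish.\<close>

definition cell :: "nat \<Rightarrow> nat option \<Rightarrow> int" where
  "cell r y = (case y of None \<Rightarrow> 0 | Some a \<Rightarrow> if a = r then 1 else - 1)"

definition word :: "nat \<Rightarrow> nat \<Rightarrow> nat labeling \<Rightarrow> int list" where
  "word r n L = map (\<lambda>i. cell r (L i)) [1..<Suc n]"

lemma length_word [simp]: "length (word r n L) = n"
  by (simp add: word_def)

lemma nth_word: "i < n \<Longrightarrow> word r n L ! i = cell r (L (Suc i))"
  by (simp add: word_def del: upt_Suc)

lemma cell_eq_0_iff: "cell r y = 0 \<longleftrightarrow> y = None"
  by (auto simp: cell_def split: option.splits)

lemma word_update:
  "i < n \<Longrightarrow> word r n (L(Suc i \<mapsto> a)) = (word r n L)[i := cell r (Some a)]"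
  by (rule nth_equalityI) (auto simp: nth_word nth_list_update)

lemma zero_in_word: "0 \<in> set (word r n L) \<longleftrightarrow> \<not> {1..n} \<subseteq> dom L"
proof -
  have "0 \<in> set (word r n L) \<longleftrightarrow> (\<exists>i\<in>{1..n}. L i = None)"
    unfolding word_def by (auto simp: cell_eq_0_iff image_iff eq_commute[of 0] simp del: upt_Suc)
  then show ?thesis by (auto simp: subset_iff domIff)
qed

lemma score_map: "score (map f [1..<Suc n]) = (\<Sum>i = 1..<n. - (f i * f (Suc i)))"
proof (induction n)
  case (Suc n)
  show ?case
  proof (cases n)
    case (Suc m)
    have "score (map f [1..<Suc (Suc n)]) = score (map f [1..<Suc n] @ [f (Suc n)])"
      by simp
    also have "\<dots> = score (map f [1..<Suc n]) - f n * f (Suc n)"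
      using Suc by (subst score_append) auto
    finally show ?thesis using Suc.IH Suc by simp
  qed simp
qed simp

text \<open>An edge has label 1 exactly if its cells have product -1. Exchanging the two values of
  \<open>r\<close> negates all cells and keeps the products.\<close>

lemma discrepancy_word:
  assumes "{1..n} \<subseteq> dom L" "ran L \<subseteq> {0, 1}" "r \<in> {0, 1}"
  shows "discrepancy (path_graph n) L = \<bar>score (word r n L)\<bar>"
proof -
  define lab where "lab i = edge_label L {i, Suc i}" for i
  have inj: "inj_on (\<lambda>i. {i, Suc i}) A" for A :: "nat set"
    by (auto simp: inj_on_def doubleton_eq_iff)
  have count: "int (edge_count (path_graph n) L b) = (\<Sum>i = 1..<n. if lab i = b then 1 else 0)" for b
  proof -
    have "{e \<in> edges (path_graph n). edge_label L e = b} = (\<lambda>i. {i, Suc i}) ` {i \<in> {1..<n}. lab i = b}"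
      by (auto simp: path_graph_def lab_def)
    then show ?thesis
      by (simp add: edge_count_def card_image[OF inj] sum.If_cases Int_def)
  qed
  have "- (cell r (L i) * cell r (L (Suc i))) = (if lab i = 1 then 1 else 0) - (if lab i = 0 then 1 else 0)"
    if "i \<in> {1..<n}" for i
  proof -
    have "{i, Suc i} \<subseteq> {1..n}" using that by auto
    then have "i \<in> dom L" "Suc i \<in> dom L" using assms(1) by blast+
    then obtain a b where ab: "L i = Some a" "L (Suc i) = Some b" by blast
    then have "a \<in> {0, 1}" "b \<in> {0, 1}" using assms(2) by (auto simp: ran_def)
    then show ?thesis using ab assms(3) by (auto simp: lab_def edge_label_def cell_def)
  qed
  then have "score (word r n L) = int (edge_count (path_graph n) L 1) - int (edge_count (path_graph n) L 0)"
    unfolding word_def score_map count sum_subtractf[symmetric] by (rule sum.cong[OF refl])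
  then show ?thesis by (simp add: discrepancy_def)
qed

section \<open>From replying strategies to game values\<close>

lemma ran_update: "ran L \<subseteq> {0, 1} \<Longrightarrow> a \<in> {0, 1} \<Longrightarrow> ran (L(v \<mapsto> a)) \<subseteq> {0, 1 :: nat}"
  by (auto simp: ran_def)

lemma game_value_path_full:
  "{1..n} \<subseteq> dom L \<Longrightarrow> game_value (path_graph n) p L = discrepancy (path_graph n) L"
  by (subst game_value.simps) (simp add: path_graph_def)

lemma game_value_path_Admirable:
  "\<not> {1..n} \<subseteq> dom L \<Longrightarrow> game_value (path_graph n) Admirable L =
    Min ((\<lambda>v. game_value (path_graph n) Impish (L(v \<mapsto> 0))) ` ({1..n} - dom L))"
  by (subst game_value.simps) (simp add: path_graph_def)

lemma game_value_path_Impish: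
  "\<not> {1..n} \<subseteq> dom L \<Longrightarrow> game_value (path_graph n) Impish L =
    Max ((\<lambda>v. game_value (path_graph n) Admirable (L(v \<mapsto> 1))) ` ({1..n} - dom L))"
  by (subst game_value.simps) (simp add: path_graph_def)

lemma fill_word:
  assumes "v \<in> {1..n} - dom L"
  shows "fill (cell r (Some a)) (word r n L) (word r n (L(v \<mapsto> a)))"
proof -
  obtain i where i: "v = Suc i" "i < n" using assms by (cases v) auto
  with assms have "word r n L ! i = 0" by (auto simp: nth_word cell_eq_0_iff)
  then show ?thesis using i word_update[of i n r L a] by (auto simp: fill_iff_update)
qed

lemma fill_wordD:
  assumes "fill (cell r (Some a)) (word r n L) w"
  shows "\<exists>v\<in>{1..n} - dom L. w = word r n (L(v \<mapsto> a))"
proof -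
  obtain i where i: "i < n" "word r n L ! i = 0" "w = (word r n L)[i := cell r (Some a)]"
    using assms by (auto simp: fill_iff_update)
  then show ?thesis
    by (intro bexI[of _ "Suc i"]) (auto simp: word_update nth_word cell_eq_0_iff)
qed

text \<open>Admirable replies. The interval is symmetric because the discrepancy is the absolute
  value of the score.\<close>

lemma game_value_Impish_le:
  assumes "controls (- B) B (word 0 n L)" "ran L \<subseteq> {0, 1}"
  shows "game_value (path_graph n) Impish L \<le> B"
  using assms
proof (induction "word 0 n L" arbitrary: L)
  case full
  then show ?case using zero_in_word[of 0 n L] by (simp add: game_value_path_full discrepancy_word[of _ _ 0] abs_le_iff)
next
  case turn
  have nf: "\<not> {1..n} \<subseteq> dom L" using turn.hyps(1) zero_in_word by blast
  have "game_value (path_graph n) Admirable (L(v \<mapsto> 1)) \<le> B" if v: "v \<in> {1..n} - dom L" for v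
  proof -
    have ran: "ran (L(v \<mapsto> 1)) \<subseteq> {0, 1}" using turn.prems by (intro ran_update) auto
    have f: "fill (- 1) (word 0 n L) (word 0 n (L(v \<mapsto> 1)))"
      using fill_word[OF v, of 0 1] by (simp add: cell_def)
    show ?thesis
    proof (cases "0 \<in> set (word 0 n (L(v \<mapsto> 1)))")
      \<comment> \<open>Impish has just labelled the last vertex, as happens for an odd number of
        blanks.\<close>
      case False
      then have "\<not> fill 1 (word 0 n (L(v \<mapsto> 1))) w" for w using ex_fill by blast
      then have "\<bar>score (word 0 n (L(v \<mapsto> 1)))\<bar> \<le> B"
        using turn.hyps(2)[OF f] by (auto simp: abs_le_iff)
      moreover have "{1..n} \<subseteq> dom (L(v \<mapsto> 1))"
        using False unfolding zero_in_word by simp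
      ultimately show ?thesis
        using discrepancy_word[OF _ ran, of n 0] by (simp only: game_value_path_full) simp
    next
      case True
      then obtain w where w: "fill 1 (word 0 n (L(v \<mapsto> 1))) w"
        and IH: "\<And>L. w = word 0 n L \<Longrightarrow> ran L \<subseteq> {0, 1} \<Longrightarrow> game_value (path_graph n) Impish L \<le> B"
        using turn.hyps(2)[OF f] by blast
      have "fill (cell 0 (Some 0)) (word 0 n (L(v \<mapsto> 1))) w" using w by (simp add: cell_def)
      from fill_wordD[OF this] obtain u where u: "u \<in> {1..n} - dom (L(v \<mapsto> 1))"
        "w = word 0 n (L(v \<mapsto> 1, u \<mapsto> 0))" by blast
      have "game_value (path_graph n) Admirable (L(v \<mapsto> 1)) \<le> game_value (path_graph n) Impish (L(v \<mapsto> 1, u \<mapsto> 0))"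
        using True u(1) unfolding zero_in_word
        by (subst game_value_path_Admirable) (auto intro!: Min_le)
      also have "\<dots> \<le> B" using IH[OF u(2)] ran_update[OF ran, of 0] by simp
      finally show ?thesis .
    qed
  qed
  then show ?case
    using nf by (subst game_value_path_Impish) (auto intro!: Max.boundedI)
qed

text \<open>Impish replies. A one-sided bound suffices: a score of at least \<open>lo\<close> has
  absolute value at least \<open>lo\<close>.\<close>

lemma game_value_Admirable_ge:
  assumes "controls lo hi (word 1 n L)" "ran L \<subseteq> {0, 1}"
  shows "lo \<le> game_value (path_graph n) Admirable L"
  using assms
proof (induction "word 1 n L" arbitrary: L)
  case full
  then show ?case using zero_in_word[of 1 n L] by (simp add: game_value_path_full discrepancy_word[of _ _ 1])
next
  case turn
  have nf: "\<not> {1..n} \<subseteq> dom L" using turn.hyps(1) zero_in_word by blast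
  have "lo \<le> game_value (path_graph n) Impish (L(v \<mapsto> 0))" if v: "v \<in> {1..n} - dom L" for v
  proof -
    have ran: "ran (L(v \<mapsto> 0)) \<subseteq> {0, 1}" using turn.prems by (intro ran_update) auto
    have f: "fill (- 1) (word 1 n L) (word 1 n (L(v \<mapsto> 0)))"
      using fill_word[OF v, of 1 0] by (simp add: cell_def)
    show ?thesis
    proof (cases "0 \<in> set (word 1 n (L(v \<mapsto> 0)))")
      case False
      then have "\<not> fill 1 (word 1 n (L(v \<mapsto> 0))) w" for w using ex_fill by blast
      then have "lo \<le> \<bar>score (word 1 n (L(v \<mapsto> 0)))\<bar>"
        using turn.hyps(2)[OF f] by auto
      moreover have "{1..n} \<subseteq> dom (L(v \<mapsto> 0))"
        using False unfolding zero_in_word by simp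
      ultimately show ?thesis
        using discrepancy_word[OF _ ran, of n 1] by (simp only: game_value_path_full) simp
    next
      case True
      then obtain w where w: "fill 1 (word 1 n (L(v \<mapsto> 0))) w"
        and IH: "\<And>L. w = word 1 n L \<Longrightarrow> ran L \<subseteq> {0, 1} \<Longrightarrow> lo \<le> game_value (path_graph n) Admirable L"
        using turn.hyps(2)[OF f] by blast
      have "fill (cell 1 (Some 1)) (word 1 n (L(v \<mapsto> 0))) w" using w by (simp add: cell_def)
      from fill_wordD[OF this] obtain u where u: "u \<in> {1..n} - dom (L(v \<mapsto> 0))"
        "w = word 1 n (L(v \<mapsto> 0, u \<mapsto> 1))" by blast
      have "lo \<le> game_value (path_graph n) Admirable (L(v \<mapsto> 0, u \<mapsto> 1))"
        using IH[OF u(2)] ran_update[OF ran, of 1] by simp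
      also have "\<dots> \<le> game_value (path_graph n) Impish (L(v \<mapsto> 0))"
        using True u(1) unfolding zero_in_word
        by (subst game_value_path_Impish) (auto intro!: Max_ge)
      finally show ?thesis .
    qed
  qed
  then show ?case
    using nf by (subst game_value_path_Admirable) (auto intro!: Min.boundedI)
qed

lemma word_empty: "word r n Map.empty = replicate n 0"
  by (rule nth_equalityI) (auto simp: nth_word cell_def)

text \<open>Whoever starts becomes the replying player, so the first label is a cell 1 for both
  players.\<close>

lemma word_endpoint: "word r (Suc n) [1 \<mapsto> r] = 1 # replicate n 0"
  using word_update[of 0 "Suc n" r Map.empty r] by (simp add: word_empty cell_def)

lemma cg_I_le: "controls (- B) B (replicate n 0) \<Longrightarrow> cg_I (path_graph n) \<le> B"
  unfolding cg_I_def by (intro game_value_Impish_le) (auto simp: word_empty)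

lemma cg_A_ge: "controls lo hi (replicate n 0) \<Longrightarrow> lo \<le> cg_A (path_graph n)"
  unfolding cg_A_def by (intro game_value_Admirable_ge) (auto simp: word_empty)

lemma cg_A_le:
  assumes "controls (- B) B (1 # replicate n 0)"
  shows "cg_A (path_graph (Suc n)) \<le> B"
proof -
  have "cg_A (path_graph (Suc n)) \<le> game_value (path_graph (Suc n)) Impish [1 \<mapsto> 0]"
    unfolding cg_A_def by (subst game_value_path_Admirable) (auto intro!: Min_le)
  also have "\<dots> \<le> B"
    using assms by (intro game_value_Impish_le) (auto simp only: word_endpoint, auto)
  finally show ?thesis .
qed

lemma cg_I_ge:
  assumes "controls lo hi (1 # replicate n 0)"
  shows "lo \<le> cg_I (path_graph (Suc n))"
proof -
  have "lo \<le> game_value (path_graph (Suc n)) Admirable [1 \<mapsto> 1]"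
    using assms by (intro game_value_Admirable_ge) (auto simp only: word_endpoint, auto)
  also have "\<dots> \<le> cg_I (path_graph (Suc n))"
    unfolding cg_I_def by (subst game_value_path_Impish) (auto intro!: Max_ge)
  finally show ?thesis .
qed

section \<open>Long paths\<close>

lemma holds_two: "holds 1 1 (replicate 2 0)"
  using safe_two[of 0] by (intro safe_replicate) simp

lemma holds_blocks:
  "holds (- 1) 1 (replicate 4 0)" "holds (- 1) 1 (replicate 6 0)" "holds (- 3) 3 (replicate 14 0)"
  "holds (- 3) 3 (replicate 16 0)" "holds 3 15 (replicate 16 0)"
  by (rule safe_replicate; simp add: safe_4 safe_6 safe_14 safe_16)+

lemma holds_join:
  assumes "holds lo\<^sub>1 hi\<^sub>1 (replicate m 0)" "holds lo\<^sub>2 hi\<^sub>2 (replicate n 0)"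
    and "lo \<le> lo\<^sub>1 + lo\<^sub>2 - 1" "hi\<^sub>1 + hi\<^sub>2 + 1 \<le> hi"
  shows "holds lo hi (replicate (m + n) 0)"
proof -
  have "holds (lo\<^sub>1 + lo\<^sub>2 - 1) (hi\<^sub>1 + hi\<^sub>2 + 1) (replicate m 0 @ replicate n 0)"
    by (rule holds_append) (use assms(1,2) in auto)
  then show ?thesis
    unfolding replicate_add by (rule forces_weaken) (use assms in auto)
qed

text \<open>Blocks of 16 are split off until a nonempty rest of at most 16 blanks remains; each
  split adds 3 for the block and 1 for the join.\<close>

lemma holds_even_upper:
  "even n \<Longrightarrow> 0 < n \<Longrightarrow> holds (1 - 4 * int ((n + 15) div 16)) (4 * int ((n + 15) div 16) - 1) (replicate n 0)"
proof (induction n rule: less_induct)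
  case (less n)
  show ?case
  proof (cases "n \<le> 16")
    case True
    \<comment> \<open>For 8, 10 and 12 blanks, two blocks within [-1, 1] and one join give 3. For 14
      and 16 three such blocks would give 5, so these lengths need strategies of their own.\<close>
    have join: "holds (- 3) 3 (replicate (k + l) 0)" if "k \<in> {4, 6}" "l \<in> {4, 6}" for k l
      by (rule holds_join[of "- 1" 1 k "- 1" 1 l]) (use that holds_blocks in auto)
    have "n = 2 * (n div 2)" using less.prems by simp
    moreover have "n div 2 \<in> {1, 2, 3, 4, 5, 6, 7, 8}" using less.prems True by auto
    ultimately have "n \<in> {2, 4, 6, 8, 10, 12, 14, 16}" by auto
    moreover have "holds (- 3) 3 (replicate 2 0)" "holds (- 3) 3 (replicate 4 0)" "holds (- 3) 3 (replicate 6 0)"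
      using holds_two holds_blocks by (auto intro: forces_weaken)
    moreover have "holds (- 3) 3 (replicate 8 0)" "holds (- 3) 3 (replicate 10 0)" "holds (- 3) 3 (replicate 12 0)"
      using join[of 4 4] join[of 4 6] join[of 6 6] by simp_all
    ultimately have "holds (- 3) 3 (replicate n 0)"
      using holds_blocks by auto
    moreover have "(n + 15) div 16 = 1" using True less.prems by (intro div_nat_eqI) auto
    ultimately show ?thesis by simp
  next
    case False
    then obtain m where m: "n = 16 + m" "0 < m" by (metis add_diff_inverse_nat le_eq_less_or_eq less_or_eq_imp_le not_le zero_less_diff)
    with less have "holds (1 - 4 * int ((m + 15) div 16)) (4 * int ((m + 15) div 16) - 1) (replicate m 0)"
      by simp
    moreover have eq: "(16 + m + 15) div 16 = (m + 15) div 16 + 1" by presburger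
    ultimately show ?thesis
      unfolding m(1) eq by (intro holds_join[OF holds_blocks(4)]) auto
  qed
qed

text \<open>Two blanks are worth 1 and pay for their join, a block of 16 gains 3 - 1 = 2. The upper
  end exceeds the number of edges, so it is no constraint.\<close>

lemma holds_even_lower:
  "even n \<Longrightarrow> 0 < n \<Longrightarrow> holds (2 * int (n div 16) + 1) (int n) (replicate n 0)"
proof (induction n rule: less_induct)
  case (less n)
  consider "n = 2" | "2 < n" "n < 16" | "n = 16" | "16 < n"
    using less.prems by (cases "n = 0 \<or> n = 1") (auto, linarith)
  then show ?case
  proof cases
    case 1
    then show ?thesis using forces_weaken[OF holds_two, of 1 2] by simp
  next
    case 2
    then obtain m where m: "n = 2 + m" "0 < m" using less_imp_add_positive by blast
    with less 2 have "holds 1 (int m) (replicate m 0)" by fastforce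
    with holds_two show ?thesis unfolding m(1) by (rule holds_join) (use 2 m in auto)
  next
    case 3
    then show ?thesis using forces_weaken[OF holds_blocks(5), of 3 16] by simp
  next
    case 4
    then obtain m where m: "n = 16 + m" "0 < m" using less_imp_add_positive by blast
    with less have "holds (2 * int (m div 16) + 1) (int m) (replicate m 0)" by simp
    with holds_blocks(5) show ?thesis unfolding m(1) by (rule holds_join) auto
  qed
qed

lemma holds_single: "holds 0 0 [1]"
  by (rule forces.final) (auto simp: fill_singleton)

lemma holds_Cons:
  assumes "holds lo hi (replicate n 0)"
  shows "holds (lo - 1) (hi + 1) (1 # replicate n 0)"
proof -
  have "holds (0 + lo - 1) (0 + hi + 1) ([1] @ replicate n 0)"
    by (rule holds_append[OF holds_single assms]) auto
  then show ?thesis by simp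
qed

lemma floor_sixteenth: "\<lfloor>real n / 16\<rfloor> = int (n div 16)"
  using floor_divide_of_nat_eq[of n 16] by simp

lemma ceiling_sixteenth: "\<lceil>real n / 16\<rceil> = int ((n + 15) div 16)"
proof -
  have "\<lceil>real n / 16\<rceil> = - (- int n div 16)"
    using ceiling_divide_eq_div[of "int n" 16] by simp
  also have "\<dots> = int ((n + 15) div 16)" by (simp add: zdiv_int)
  finally show ?thesis .
qed

lemma controls_weaken: "controls lo hi w \<Longrightarrow> lo' \<le> lo \<Longrightarrow> hi \<le> hi' \<Longrightarrow> controls lo' hi' w"
proof (induction rule: controls.induct)
  case (turn w)
  show ?case
    by (rule controls.turn, rule turn.hyps) (drule turn.IH, use turn.prems in force)
qed (auto intro: controls.full)

text \<open>Gives up 1 at each end to include the empty word, for which the interval of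
  \<open>holds_even_upper\<close> would be [1, -1].\<close>

lemma even_upper:
  assumes "even m"
  shows "holds (- 4 * int ((m + 15) div 16)) (4 * int ((m + 15) div 16)) (replicate m 0)"
proof (cases "m = 0")
  case True
  then show ?thesis by (auto intro: forces.final simp: fill_def)
next
  case False
  then show ?thesis using holds_even_upper[OF assms] by (auto intro: forces_weaken)
qed

lemma even_lower:
  assumes "even m"
  shows "holds (2 * int (m div 16)) (int m) (replicate m 0)"
proof (cases "m = 0")
  case True
  then show ?thesis by (auto intro: forces.final simp: fill_def)
next
  case False
  then show ?thesis using holds_even_lower[OF assms] by (auto intro: forces_weaken)
qed

text \<open>\<open>(m + 16) div 16\<close> is the rounded-up sixteenth of the whole length
  \<open>m + 1\<close>. The edge at the labelled endpoint costs the 1 by which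
  \<open>holds_even_upper\<close> stays below a multiple of 4.\<close>

lemma Cons_upper:
  assumes "even m"
  shows "holds (- 4 * int ((m + 16) div 16)) (4 * int ((m + 16) div 16)) (1 # replicate m 0)"
proof (cases "m = 0")
  case True
  then show ?thesis using forces_weaken[OF holds_single] by simp
next
  case False
  have "(m + 15) div 16 \<le> (m + 16) div 16" by (intro div_le_mono) simp
  then show ?thesis using forces_weaken[OF holds_Cons[OF holds_even_upper[OF assms]]] False by simp
qed

lemma Cons_lower:
  assumes "even m"
  shows "holds (2 * int (m div 16)) (int m + 1) (1 # replicate m 0)"
proof (cases "m = 0")
  case True
  then show ?thesis using forces_weaken[OF holds_single] by simp
next
  case False
  then show ?thesis using holds_Cons[OF holds_even_lower[OF assms]] by simp
qed

lemma controls_extra_zero: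
  assumes "holds lo hi w" "set w \<subseteq> {- 1, 0, 1}"
  shows "controls (lo - 1) (hi + 1) (w @ [0])"
  using controls_extra[OF assms] by blast

theorem theorem5p3:
  fixes n :: nat
  assumes "n \<ge> 1"
  shows "(even n \<longrightarrow>
            2 * \<lfloor>real n / 16\<rfloor> + 1 \<le> cg_A (path_graph n) \<and>
            cg_A (path_graph n) \<le> 4 * \<lceil>real n / 16\<rceil> + 5 \<and>
            2 * \<lfloor>real n / 16\<rfloor> - 5 \<le> cg_I (path_graph n) \<and>
            cg_I (path_graph n) \<le> 4 * \<lceil>real n / 16\<rceil> - 1) \<and>
         (odd n \<longrightarrow>
            2 * \<lfloor>real n / 16\<rfloor> - 4 \<le> cg_A (path_graph n) \<and>
            cg_A (path_graph n) \<le> 4 * \<lceil>real n / 16\<rceil> \<and>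
            2 * \<lfloor>real n / 16\<rfloor> \<le> cg_I (path_graph n) \<and>
            cg_I (path_graph n) \<le> 4 * \<lceil>real n / 16\<rceil> + 4)"
  unfolding floor_sixteenth ceiling_sixteenth
proof (intro conjI impI)
  assume n: "even n"
  with assms have "0 < n" by simp
  \<comment> \<open>For a starting player on an even path, two vertices are set aside: the endpoint
    labelled first and, at the other end, the extra vertex. The \<open>m\<close> blanks between them
    are even in number.\<close>
  have "n = Suc (Suc (n - 2))" using n \<open>0 < n\<close> by (cases n rule: nat.exhaust; cases "n - 1"; simp)
  then obtain m where m: "n = Suc (Suc m)" by blast
  with n have "even m" by simp
  have snoc: "(1 # replicate m 0) @ [0] = 1 # replicate (Suc m) (0::int)"
    by (simp add: replicate_append_same)
  show "2 * int (n div 16) + 1 \<le> cg_A (path_graph n)"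
    using holds_imp_controls[OF holds_even_lower[OF n \<open>0 < n\<close>]] by (rule cg_A_ge)
  show "cg_I (path_graph n) \<le> 4 * int ((n + 15) div 16) - 1"
    using holds_imp_controls[OF holds_even_upper[OF n \<open>0 < n\<close>]] by (intro cg_I_le) simp
  have le: "(m + 16) div 16 \<le> (n + 15) div 16" using m by (intro div_le_mono) simp
  \<comment> \<open>\<open>Cons_upper\<close> and the extra vertex lead to
    \<open>4 * int ((m + 16) div 16) + 1\<close>, which lies within the claimed bound.\<close>
  have "controls (- (4 * int ((n + 15) div 16) + 5)) (4 * int ((n + 15) div 16) + 5) (1 # replicate (Suc m) 0)"
    unfolding snoc[symmetric]
    by (rule controls_weaken[OF controls_extra_zero[OF Cons_upper[OF \<open>even m\<close>]]]) (use le in auto)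
  then show "cg_A (path_graph n) \<le> 4 * int ((n + 15) div 16) + 5"
    unfolding m by (rule cg_A_le)
  have "controls (2 * int (m div 16) - 1) (int m + 1 + 1) (1 # replicate (Suc m) 0)"
    unfolding snoc[symmetric] by (rule controls_extra_zero[OF Cons_lower[OF \<open>even m\<close>]]) auto
  then have "2 * int (m div 16) - 1 \<le> cg_I (path_graph n)" unfolding m by (rule cg_I_ge)
  \<comment> \<open>Dropping two vertices can lower the quotient by 1 and the bound by 2, which
    leaves \<open>2 * int (n div 16) - 3\<close>.\<close>
  moreover have "n div 16 \<le> m div 16 + 1" using m by simp
  ultimately show "2 * int (n div 16) - 5 \<le> cg_I (path_graph n)" by linarith
next
  assume n: "odd n"
  then obtain m where m: "n = Suc m" "even m" by (cases n) auto
  have snoc: "replicate m 0 @ [0] = replicate n (0::int)"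
    by (simp add: m replicate_append_same)
  \<comment> \<open>An odd number is no multiple of 16, so removing one vertex keeps the
    quotient.\<close>
  have "\<not> 16 dvd n" using n by (auto elim!: dvdE)
  then have div: "n div 16 = m div 16" by (simp add: m(1) div_Suc mod_eq_0_iff_dvd)
  \<comment> \<open>Here Admirable starts and Impish replies; the last vertex is the extra one that
    makes the rest even.\<close>
  have "controls (2 * int (m div 16) - 1) (int m + 1) (replicate n 0)"
    unfolding snoc[symmetric] by (rule controls_extra_zero[OF even_lower[OF m(2)]]) auto
  then have "2 * int (m div 16) - 1 \<le> cg_A (path_graph n)" by (rule cg_A_ge)
  then show "2 * int (n div 16) - 4 \<le> cg_A (path_graph n)" unfolding div by simp
  show "cg_A (path_graph n) \<le> 4 * int ((n + 15) div 16)"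
    using holds_imp_controls[OF Cons_upper[OF m(2)]] unfolding m(1) by (intro cg_A_le) simp
  show "2 * int (n div 16) \<le> cg_I (path_graph n)"
    using holds_imp_controls[OF Cons_lower[OF m(2)]] unfolding div unfolding m(1) by (rule cg_I_ge)
  have le: "(m + 15) div 16 \<le> (n + 15) div 16" using m by (intro div_le_mono) simp
  have "controls (- (4 * int ((n + 15) div 16) + 4)) (4 * int ((n + 15) div 16) + 4) (replicate n 0)"
    unfolding snoc[symmetric]
    by (rule controls_weaken[OF controls_extra_zero[OF even_upper[OF m(2)]]]) (use le in auto)
  then show "cg_I (path_graph n) \<le> 4 * int ((n + 15) div 16) + 4" by (rule cg_I_le)
qed

end
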